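(* Let $X$ be a finite simplicial complex of dimension $d\ge 1$ on a vertex set $V$ with $|V|=n$, and assume $X$ has a complete skeleton. Then $\lambda(X)\le h(X)$.
   Context: A simplicial complex $X$ on vertex set $V$ is a family of subsets of $V$ (cells) closed under taking subsets; $X^j$ is the set of $j$-cells (cells of size $j+1$), $X^{-1}=\{\varnothing\}$, and $d=\dim X$ is the maximal dimension of a cell. $X$ has a complete skeleton if every subset of $V$ of size at most $d$ is a cell of $X$. For $j\ge 1$ an oriented $j$-cell is a $j$-cell together with an ordering of its vertices up to even permutations, written $[\sigma_0,\dots,\sigma_j]$; $\overline{\sigma}$ denotes the opposite orientation (0-cells and the empty cell have a single orientation). $\Omega^j$ is the space of real functions $f$ on oriented $j$-cells with $f(\overline\sigma)=-f(\sigma)$, with inner product $\langle f,g\rangle=\sum_{\sigma\in X^j}f(\sigma)g(\sigma)$. For an oriented cell $\sigma=[\sigma_0,\dots,\sigma_{j-1}]$ and a vertex $v\notin\sigma$ with $\sigma\cup\{v\}\in X$ write $v\sim\sigma$ and $v\sigma=[v,\sigma_0,\dots,\sigma_{j-1}]$. The boundary operator $\partial_j:\Omega^j\to\Omega^{j-1}$ is $(\partial_j f)(\sigma)=\sum_{v\sim\sigma}f(v\sigma)$, and its adjoint $\partial_j^*:\Omega^{j-1}\to\Omega^j$ is $(\partial_j^*f)([\sigma_0,\dots,\sigma_j])=\sum_{i=0}^j(-1)^if([\sigma_0,\dots,\sigma_{i-1},\sigma_{i+1},\dots,\sigma_j])$. The upper Laplacian is $\Delta^+=\partial_d\partial_d^*:\Omega^{d-1}\to\Omega^{d-1}$.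 Let $Z_{d-1}=\ker\partial_{d-1}\subseteq\Omega^{d-1}$; it is invariant under $\Delta^+$. The spectral gap is $\lambda(X)=\min\operatorname{Spec}(\Delta^+|_{Z_{d-1}})$. For disjoint $A_0,\dots,A_d\subseteq V$, $F(A_0,\dots,A_d)$ denotes the set of $d$-cells of $X$ having exactly one vertex in each $A_i$. The Cheeger constant is $h(X)=\min \frac{n\,|F(A_0,\dots,A_d)|}{|A_0|\cdots|A_d|}$, the minimum over all partitions $V=A_0\sqcup\dots\sqcup A_d$ into nonempty sets. *)

theory Defs
  imports "HOL-Analysis.Analysis" "HOL-Combinatorics.Combinatorics"
begin

section \<open>Simplicial complexes\<close>

definition abstract_simplicial_complex :: "'a set \<Rightarrow> 'a set set \<Rightarrow> bool" where
  "abstract_simplicial_complex V X \<longleftrightarrow> {} \<in> X \<and> X \<subseteq> Pow V \<and> (\<forall>\<sigma>\<in>X. \<forall>\<tau>\<subseteq>\<sigma>. \<tau> \<in> X)"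

text \<open>Dimensions are integers, since the empty cell has dimension \<open>-1\<close>. All cells are meant to be
  finite.\<close>

definition cell_dim :: "'a set \<Rightarrow> int" where
  "cell_dim \<sigma> = int (card \<sigma>) - 1"

definition cells :: "'a set set \<Rightarrow> int \<Rightarrow> 'a set set" where
  "cells X j = {\<sigma> \<in> X. cell_dim \<sigma> = j}"

definition complex_dim :: "'a set set \<Rightarrow> int" where
  "complex_dim X = Max (cell_dim ` X)"

definition complete_skeleton :: "'a set \<Rightarrow> 'a set set \<Rightarrow> bool" where
  "complete_skeleton V X \<longleftrightarrow> (\<forall>\<sigma>\<subseteq>V. int (card \<sigma>) \<le> complex_dim X \<longrightarrow> \<sigma> \<in> X)"


section \<open>Oriented cells\<close>

text \<open>An oriented cell is the class of all orderings of its vertices that differ by even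
  permutations; \<open>orient [\<sigma>\<^sub>0, \<dots>, \<sigma>\<^sub>j]\<close> is the oriented cell written
  \<open>[\<sigma>\<^sub>0, \<dots>, \<sigma>\<^sub>j]\<close> in the literature. For \<open>j \<le> 0\<close> there is only one class per cell.\<close>

definition orient :: "'a list \<Rightarrow> 'a list set" where
  "orient xs = {permute_list p xs | p. p permutes {..<length xs} \<and> evenperm p}"

definition oriented_cells :: "'a set set \<Rightarrow> int \<Rightarrow> 'a list set set" where
  "oriented_cells X j = {orient xs | xs. distinct xs \<and> set xs \<in> cells X j}"

definition underlying_cell :: "'a list set \<Rightarrow> 'a set" where
  "underlying_cell \<sigma> = (\<Union>xs\<in>\<sigma>. set xs)"

text \<open>Meaningful only for oriented cells of dimension at least \<open>1\<close>.\<close>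

definition opposite :: "'a list set \<Rightarrow> 'a list set" where
  "opposite \<sigma> = {permute_list p xs | p xs. xs \<in> \<sigma> \<and> p permutes {..<length xs} \<and> \<not> evenperm p}"

definition adjacent :: "'a set set \<Rightarrow> 'a \<Rightarrow> 'a list set \<Rightarrow> bool" where
  "adjacent X v \<sigma> \<longleftrightarrow> v \<notin> underlying_cell \<sigma> \<and> insert v (underlying_cell \<sigma>) \<in> X"

text \<open>The oriented cell \<open>v\<sigma> = [v, \<sigma>\<^sub>0, \<dots>, \<sigma>\<^sub>j]\<close>. The sets in the union all coincide,
  so this does not depend on the ordering chosen to represent \<open>\<sigma>\<close>.\<close>

definition cone :: "'a \<Rightarrow> 'a list set \<Rightarrow> 'a list set" where
  "cone v \<sigma> = (\<Union>xs\<in>\<sigma>. orient (v # xs))"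


section \<open>Forms, boundary operators and the upper Laplacian\<close>

text \<open>The space \<open>\<Omega>\<^sup>j\<close>. Functions on oriented \<open>j\<close>-cells are extended by \<open>0\<close> to the whole type.\<close>

definition forms :: "'a set set \<Rightarrow> int \<Rightarrow> ('a list set \<Rightarrow> real) set" where
  "forms X j = {f. (\<forall>\<sigma>. \<sigma> \<notin> oriented_cells X j \<longrightarrow> f \<sigma> = 0) \<and>
     (j \<ge> 1 \<longrightarrow> (\<forall>\<sigma>\<in>oriented_cells X j. f (opposite \<sigma>) = - f \<sigma>))}"

definition boundary :: "'a set set \<Rightarrow> int \<Rightarrow> ('a list set \<Rightarrow> real) \<Rightarrow> ('a list set \<Rightarrow> real)" where
  "boundary X j f = (\<lambda>\<sigma>. if \<sigma> \<in> oriented_cells X (j - 1)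
     then (\<Sum>v | adjacent X v \<sigma>. f (cone v \<sigma>)) else 0)"

text \<open>The adjoint \<open>\<partial>\<^sub>j\<^sup>*\<close> of the boundary operator. On forms, the value does not depend on the
  representative \<open>xs\<close>; \<open>take i xs @ drop (Suc i) xs\<close> is \<open>xs\<close> with its \<open>i\<close>-th entry deleted.\<close>

definition coboundary :: "'a set set \<Rightarrow> int \<Rightarrow> ('a list set \<Rightarrow> real) \<Rightarrow> ('a list set \<Rightarrow> real)" where
  "coboundary X j f = (\<lambda>\<sigma>. if \<sigma> \<in> oriented_cells X j
     then (let xs = (SOME xs. xs \<in> \<sigma>)
           in \<Sum>i<length xs. (- 1) ^ i * f (orient (take i xs @ drop (Suc i) xs)))
     else 0)"

definition upper_laplacian :: "'a set set \<Rightarrow> ('a list set \<Rightarrow> real) \<Rightarrow> ('a list set \<Rightarrow> real)" where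
  "upper_laplacian X f = boundary X (complex_dim X) (coboundary X (complex_dim X) f)"

definition cycles :: "'a set set \<Rightarrow> int \<Rightarrow> ('a list set \<Rightarrow> real) set" where
  "cycles X j = {f \<in> forms X j. boundary X j f = (\<lambda>_. 0)}"

text \<open>Spectrum of the restriction of a linear operator \<open>T\<close> to an invariant finite-dimensional
  space \<open>Z\<close> of real functions, i.e. the set of its (real) eigenvalues. The operator considered below
  is self-adjoint.\<close>

definition spectrum_on :: "('b \<Rightarrow> real) set \<Rightarrow> (('b \<Rightarrow> real) \<Rightarrow> ('b \<Rightarrow> real)) \<Rightarrow> real set" where
  "spectrum_on Z T = {c. \<exists>f\<in>Z. f \<noteq> (\<lambda>_. 0) \<and> T f = (\<lambda>x. c * f x)}"

definition spectral_gap :: "'a set set \<Rightarrow> real" where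
  "spectral_gap X = Min (spectrum_on (cycles X (complex_dim X - 1)) (upper_laplacian X))"


section \<open>The Cheeger constant\<close>

text \<open>Partitions into \<open>d + 1\<close> blocks are given by indexed families \<open>A 0, \<dots>, A d\<close>; values of \<open>A\<close>
  beyond \<open>d\<close> are irrelevant.\<close>

definition is_partition :: "'a set \<Rightarrow> nat \<Rightarrow> (nat \<Rightarrow> 'a set) \<Rightarrow> bool" where
  "is_partition V d A \<longleftrightarrow>
     (\<forall>i\<le>d. A i \<noteq> {}) \<and> disjoint_family_on A {..d} \<and> (\<Union>i\<le>d. A i) = V"

definition transversal_cells :: "'a set set \<Rightarrow> nat \<Rightarrow> (nat \<Rightarrow> 'a set) \<Rightarrow> 'a set set" where
  "transversal_cells X d A = {\<sigma> \<in> cells X (int d). \<forall>i\<le>d. card (\<sigma> \<inter> A i) = 1}"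

definition cheeger_constant :: "'a set \<Rightarrow> 'a set set \<Rightarrow> real" where
  "cheeger_constant V X = (let d = nat (complex_dim X) in
     Min {real (card V) * real (card (transversal_cells X d A)) / (\<Prod>i\<le>d. real (card (A i))) | A.
       is_partition V d A})"

end

theory Submission
  imports Defs
begin

text \<open>For a partition \<open>A\<^sub>0, \<dots>, A\<^sub>d\<close> let \<open>f [\<sigma>\<^sub>0, \<dots>, \<sigma>\<^sub>d\<^sub>-\<^sub>1]\<close> be \<open>\<plusminus>|A\<^sub>k|\<close> if the \<open>\<sigma>\<^sub>i\<close> lie in distinct blocks
  and \<open>A\<^sub>k\<close> is the remaining one, and \<open>0\<close> otherwise; the sign is that of the permutation formed by the
  block indices followed by \<open>k\<close>. Equivalently, \<open>f \<sigma>\<close> is the sum over all vertices \<open>v\<close> of the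
  Levi-Civita symbol of the blocks of \<open>\<sigma>, v\<close>. Hence \<open>f\<close> is a cycle by antisymmetry. The
  coboundary of the Levi-Civita symbol is an alternating function of \<open>d + 2\<close> of the \<open>d + 1\<close> block
  indices, so it vanishes, whence \<open>\<partial>\<^sup>* f\<close> is \<open>\<plusminus>n\<close> on the cells counted by the Cheeger quotient and
  \<open>0\<close> elsewhere. Thus the Rayleigh quotient of \<open>f\<close> is the Cheeger quotient, and it bounds the least
  eigenvalue from above.

  Inner products are taken over all orderings of all cells, which multiplies them by a constant
  and makes a choice of orientations unnecessary.\<close>

section \<open>Rayleigh quotients\<close>

text \<open>\<open>\<phi>\<close> may repeat values: \<open>I\<close> will consist of the vertex
  lists of length \<open>d\<close> and \<open>\<phi>\<close> will be \<open>orient\<close>, so an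
  oriented cell is counted once for each of its orderings. Closedness and continuity refer to
  pointwise convergence; \<open>support\<close> together with \<open>finite_I\<close> makes
  \<open>Z\<close> finite-dimensional.\<close>

locale symmetric_operator =
  fixes I :: "'i set" and \<phi> :: "'i \<Rightarrow> 'b" and Z :: "('b \<Rightarrow> real) set"
    and T :: "('b \<Rightarrow> real) \<Rightarrow> ('b \<Rightarrow> real)"
  assumes finite_I: "finite I"
    and lincomb: "\<And>f g c. f \<in> Z \<Longrightarrow> g \<in> Z \<Longrightarrow> (\<lambda>x. f x + c * g x) \<in> Z"
    and support: "\<And>f x. f \<in> Z \<Longrightarrow> x \<notin> \<phi> ` I \<Longrightarrow> f x = 0"
    and closed_Z: "closed Z"
    and T_in: "\<And>f. f \<in> Z \<Longrightarrow> T f \<in> Z"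
    and T_lincomb: "\<And>f g c. f \<in> Z \<Longrightarrow> g \<in> Z \<Longrightarrow> T (\<lambda>x. f x + c * g x) = (\<lambda>x. T f x + c * T g x)"
    and T_sym: "\<And>f g. f \<in> Z \<Longrightarrow> g \<in> Z \<Longrightarrow>
        (\<Sum>i\<in>I. T f (\<phi> i) * g (\<phi> i)) = (\<Sum>i\<in>I. f (\<phi> i) * T g (\<phi> i))"
    and T_cont: "\<And>x. continuous_on UNIV (\<lambda>f. T f x)"
begin

section \<open>The inner product indexed by \<open>I\<close>\<close>

definition ip :: "('b \<Rightarrow> real) \<Rightarrow> ('b \<Rightarrow> real) \<Rightarrow> real" where
  "ip f g = (\<Sum>i\<in>I. f (\<phi> i) * g (\<phi> i))"

lemma ip_commute: "ip f g = ip g f"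
  by (simp add: ip_def mult.commute)

lemma ip_add_scale: "ip (\<lambda>x. f x + c * g x) h = ip f h + c * ip g h"
  by (simp add: ip_def sum.distrib sum_distrib_left algebra_simps)

lemma ip_scale: "ip (\<lambda>x. c * g x) h = c * ip g h"
  by (simp add: ip_def sum_distrib_left algebra_simps)

lemma ip_add_scale': "ip h (\<lambda>x. f x + c * g x) = ip h f + c * ip h g"
  using ip_add_scale by (simp add: ip_commute)

lemma ip_scale': "ip h (\<lambda>x. c * g x) = c * ip h g"
  using ip_scale by (simp add: ip_commute)

lemma ip_normalize:
  assumes "ip f f > 0"
  shows "ip (\<lambda>x. inverse (sqrt (ip f f)) * f x) (\<lambda>x. inverse (sqrt (ip f f)) * f x) = 1"
  using assms real_sqrt_mult_self[of "ip f f"] unfolding ip_scale ip_scale' by (simp add: field_simps)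

lemma ip_nonneg: "ip f f \<ge> 0"
  by (simp add: ip_def sum_nonneg)

lemma ip_eq_0:
  assumes "f \<in> Z" "ip f f = 0"
  shows "f = (\<lambda>_. 0)"
proof
  fix x
  have "\<forall>i\<in>I. f (\<phi> i) * f (\<phi> i) = 0"
    using assms(2) finite_I by (subst (asm) ip_def, subst (asm) sum_nonneg_eq_0_iff) auto
  then show "f x = 0"
    using support[OF assms(1), of x] by (cases "x \<in> \<phi> ` I") auto
qed

lemma zero_in: "f \<in> Z \<Longrightarrow> (\<lambda>_. 0) \<in> Z"
  using lincomb[of f f "-1"] by simp

lemma scale_in: "f \<in> Z \<Longrightarrow> (\<lambda>x. c * f x) \<in> Z"
  using lincomb[OF zero_in, of f f c] by simp

lemma T_scale:
  assumes "f \<in> Z" shows "T (\<lambda>x. c * f x) = (\<lambda>x. c * T f x)"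
proof -
  have "T (\<lambda>x. f x + (c - 1) * f x) = (\<lambda>x. T f x + (c - 1) * T f x)"
    by (rule T_lincomb[OF assms assms])
  then show ?thesis by (simp add: algebra_simps)
qed

text \<open>Each single square is at most the whole sum, so unit vectors take values in
  \<open>[-1, 1]\<close>. The sphere is thus a closed subset of a cube that is compact by
  Tychonoff's theorem.\<close>

lemma compact_sphere: "compact {f \<in> Z. ip f f = 1}"
proof -
  have cont: "continuous_on UNIV (\<lambda>f::'b \<Rightarrow> real. f x)" for x
    by simp
  have "compact (PiE UNIV (\<lambda>_::'b. {-1..1::real}))"
    using compactin_PiE[of "\<lambda>_. euclidean" "UNIV::'b set" "\<lambda>_. {-1..1::real}"]
    by (simp add: euclidean_product_topology)
  moreover have "closed {f. ip f f = 1}"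
    unfolding ip_def by (intro closed_Collect_eq continuous_intros cont)
  then have "closed {f \<in> Z. ip f f = 1}"
    using closed_Z by (simp add: closed_Int Collect_conj_eq)
  moreover have "{f \<in> Z. ip f f = 1} \<subseteq> PiE UNIV (\<lambda>_. {-1..1})"
  proof safe
    fix f x assume f: "f \<in> Z" "ip f f = 1"
    have "\<bar>f x\<bar> \<le> 1"
    proof (cases "x \<in> \<phi> ` I")
      case True
      then obtain i where i: "i \<in> I" "x = \<phi> i" by blast
      have "f (\<phi> i) * f (\<phi> i) \<le> ip f f"
        unfolding ip_def by (rule member_le_sum) (use i finite_I in auto)
      then show ?thesis using f i abs_square_le_1[of "f (\<phi> i)"] by (simp add: power2_eq_square)
    qed (simp add: support[OF f(1)])
    then show "f x \<in> {-1..1}" by auto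
  qed auto
  ultimately show ?thesis
    by (metis (no_types, lifting) compact_Int_closed inf.absorb_iff2)
qed

text \<open>Needed because \<open>Min\<close> is unspecified on infinite sets. By Bessel's inequality at each point
  of \<open>I\<close>, orthonormal eigenvectors number at most \<open>card I\<close>.\<close>

lemma finite_spectrum: "finite (spectrum_on Z T)"
proof -
  define e where "e c = (SOME f. f \<in> Z \<and> ip f f = 1 \<and> T f = (\<lambda>x. c * f x))" for c
  have e: "e c \<in> Z" "ip (e c) (e c) = 1" "T (e c) = (\<lambda>x. c * e c x)" if c: "c \<in> spectrum_on Z T" for c
  proof -
    obtain f where f: "f \<in> Z" "f \<noteq> (\<lambda>_. 0)" "T f = (\<lambda>x. c * f x)"
      using c unfolding spectrum_on_def by blast
    define g where "g = (\<lambda>x. inverse (sqrt (ip f f)) * f x)"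
    have "ip f f > 0" using ip_eq_0 ip_nonneg f by (metis less_eq_real_def)
    then have "ip g g = 1"
      unfolding g_def by (rule ip_normalize)
    moreover have "g \<in> Z" unfolding g_def by (rule scale_in[OF f(1)])
    moreover have "T g = (\<lambda>x. c * g x)"
      unfolding g_def T_scale[OF f(1)] f(3) by (simp add: mult_ac)
    ultimately have "\<exists>f. f \<in> Z \<and> ip f f = 1 \<and> T f = (\<lambda>x. c * f x)" by blast
    from someI_ex[OF this] show "e c \<in> Z" "ip (e c) (e c) = 1" "T (e c) = (\<lambda>x. c * e c x)"
      unfolding e_def by auto
  qed
  have orth: "ip (e c) (e c') = 0" if "c \<in> spectrum_on Z T" "c' \<in> spectrum_on Z T" "c \<noteq> c'" for c c'
  proof -
    have "c * ip (e c) (e c') = c' * ip (e c) (e c')"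
      using T_sym[OF e(1)[OF that(1)] e(1)[OF that(2)]] that
      by (simp add: e ip_def sum_distrib_left mult_ac)
    then show ?thesis using that by simp
  qed
  have "card C \<le> card I" if C: "finite C" "C \<subseteq> spectrum_on Z T" for C
  proof -
    have bessel: "(\<Sum>c\<in>C. (e c (\<phi> i))\<^sup>2) \<le> 1" if i: "i \<in> I" for i
    proof -
      define s where "s = (\<Sum>c\<in>C. (e c (\<phi> i))\<^sup>2)"
      \<comment> \<open>\<open>p\<close> is the orthogonal projection of the point mass at
        \<open>i\<close> onto the span of the eigenvectors, read as functions on \<open>I\<close>.
        Its squared norm and its value at \<open>i\<close> are both \<open>s\<close>, so its squared
        distance from the point mass is \<open>1 - s\<close>.\<close>
      define p where "p j = (\<Sum>c\<in>C. e c (\<phi> i) * e c (\<phi> j))" for j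
      have "(\<Sum>j\<in>I. p j * p j) = (\<Sum>j\<in>I. \<Sum>c\<in>C. \<Sum>c'\<in>C. e c (\<phi> i) * e c' (\<phi> i) * (e c (\<phi> j) * e c' (\<phi> j)))"
        unfolding p_def sum_product by (simp add: mult_ac)
      also have "\<dots> = (\<Sum>c\<in>C. \<Sum>c'\<in>C. e c (\<phi> i) * e c' (\<phi> i) * ip (e c) (e c'))"
        unfolding ip_def sum_distrib_left
        by (subst sum.swap, rule sum.cong[OF refl], subst sum.swap, simp)
      also have "\<dots> = (\<Sum>c\<in>C. \<Sum>c'\<in>C. if c = c' then e c (\<phi> i) * e c' (\<phi> i) else 0)"
        using C e(2) orth by (intro sum.cong refl) (auto simp: subset_iff)
      also have "\<dots> = s"
        using C by (simp add: s_def power2_eq_square)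
      finally have pp: "(\<Sum>j\<in>I. p j * p j) = s" .
      have pi: "p i = s" by (simp add: p_def s_def power2_eq_square)
      have "0 \<le> (\<Sum>j\<in>I. ((if j = i then 1 else 0) - p j)\<^sup>2)" by (simp add: sum_nonneg)
      also have "\<dots> = (\<Sum>j\<in>I. (if j = i then 1 - 2 * p j else 0) + p j * p j)"
        by (intro sum.cong) (auto simp: power2_eq_square algebra_simps)
      also have "\<dots> = 1 - s"
        using i finite_I by (simp add: sum.distrib pp pi)
      finally show ?thesis by (simp add: s_def)
    qed
    have "real (card C) = (\<Sum>c\<in>C. ip (e c) (e c))"
      using C e(2) by (simp add: subset_iff)
    also have "\<dots> = (\<Sum>i\<in>I. \<Sum>c\<in>C. (e c (\<phi> i))\<^sup>2)"
      unfolding ip_def power2_eq_square by (rule sum.swap)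
    also have "\<dots> \<le> (\<Sum>i\<in>I. 1)" by (intro sum_mono bessel)
    finally show ?thesis by simp
  qed
  then show ?thesis
    by (metis finite_if_finite_subsets_card_bdd)
qed

text \<open>The Rayleigh quotient attains its minimum \<open>m\<close> on the compact sphere, which
  is nonempty because of \<open>f\<close>. A first-order variation at the minimizer \<open>g\<close>
  shows that \<open>g\<close> is an eigenvector for \<open>m\<close>; hence the spectrum is nonempty
  and its least element is at most \<open>m\<close>.\<close>

lemma Min_spectrum_le:
  assumes f: "f \<in> Z" "f \<noteq> (\<lambda>_. 0)"
  shows "Min (spectrum_on Z T) * ip f f \<le> ip (T f) f"
proof -
  have normalize: "ip f f > 0 \<and> (\<lambda>x. inverse (sqrt (ip f f)) * f x) \<in> {f \<in> Z. ip f f = 1}"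
    if "f \<in> Z" "f \<noteq> (\<lambda>_. 0)" for f
  proof -
    have "ip f f > 0" using ip_eq_0 ip_nonneg that by (metis less_eq_real_def)
    then show ?thesis
      using scale_in[OF that(1)] ip_normalize by blast
  qed
  have "continuous_on {f \<in> Z. ip f f = 1} (\<lambda>f. ip (T f) f)"
    unfolding ip_def
    by (rule continuous_on_subset[OF _ subset_UNIV], intro continuous_intros T_cont) simp
  moreover have "{f \<in> Z. ip f f = 1} \<noteq> {}" using normalize[OF f] by blast
  ultimately obtain g where g: "g \<in> Z" "ip g g = 1"
    and min: "\<And>h. h \<in> Z \<Longrightarrow> ip h h = 1 \<Longrightarrow> ip (T g) g \<le> ip (T h) h"
    using continuous_attains_inf[OF compact_sphere, of "\<lambda>f. ip (T f) f"] by auto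
  define m where "m = ip (T g) g"
  have le: "m * ip h h \<le> ip (T h) h" if h: "h \<in> Z" for h
  proof (cases "h = (\<lambda>_. 0)")
    case True
    then show ?thesis by (simp add: ip_def)
  next
    case False
    define k where "k = (\<lambda>x. inverse (sqrt (ip h h)) * h x)"
    have k: "ip h h > 0" "k \<in> Z" "ip k k = 1" using normalize[OF h False] by (auto simp: k_def)
    have "m \<le> ip (T k) k" unfolding m_def using min k by blast
    also have "\<dots> = ip (T h) h / ip h h"
      using k(1) real_sqrt_mult_self[of "ip h h"]
      unfolding k_def T_scale[OF h] ip_scale ip_scale' by (simp add: field_simps)
    finally show ?thesis using k(1) by (simp add: field_simps)
  qed
  \<comment> \<open>The residual of \<open>g\<close> serves as the direction of variation, since the
    derivative in that direction is \<open>2 * ip r r\<close>.\<close>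
  define r where "r = (\<lambda>x. T g x + (- m) * g x)"
  have r: "r \<in> Z" unfolding r_def by (rule lincomb[OF T_in[OF g(1)] g(1)])
  \<comment> \<open>This is \<open>le\<close> for \<open>g + t * r\<close>: the constant term
    vanishes as \<open>ip g g = 1\<close>, and by symmetry of \<open>T\<close> the linear
    coefficient is \<open>2 * (ip (T g) r - m * ip g r)\<close>, which is
    \<open>2 * ip r r\<close>.\<close>
  have "2 * t * ip r r + t\<^sup>2 * (ip (T r) r - m * ip r r) \<ge> 0" for t
  proof -
    have gt: "(\<lambda>x. g x + t * r x) \<in> Z" by (rule lincomb[OF g(1) r])
    have "ip r r = ip (T g) r - m * ip g r"
      using ip_add_scale[of "T g" "-m" g r] by (simp add: r_def)
    then have "ip (T g) r = ip r r + m * ip g r" by simp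
    moreover have "ip (T r) g = ip (T g) r"
      using T_sym[OF r g(1)] by (simp add: ip_def mult.commute)
    ultimately show ?thesis
      using le[OF gt] g(2) unfolding T_lincomb[OF g(1) r] ip_add_scale ip_add_scale'
      by (simp add: m_def ip_commute[of r g] power2_eq_square algebra_simps)
  qed
  note quad = this
  have "ip r r = 0"
  proof (rule ccontr)
    assume "ip r r \<noteq> 0"
    then have pos: "ip r r > 0" using ip_nonneg[of r] by simp
    \<comment> \<open>\<open>q\<close> bounds the quadratic coefficient and is positive, so
      \<open>t\<close> below is the minimizer of \<open>2 * t * ip r r + t\<^sup>2 * q\<close>, with
      a negative minimum.\<close>
    define q where "q = \<bar>ip (T r) r - m * ip r r\<bar> + 1"
    have q: "q > 0" "ip (T r) r - m * ip r r \<le> q" by (auto simp: q_def)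
    define t where "t = - ip r r / q"
    have "0 \<le> 2 * t * ip r r + t\<^sup>2 * q"
      using quad[of t] mult_left_mono[OF q(2), of "t\<^sup>2"] by simp
    also have "\<dots> = - (ip r r)\<^sup>2 / q"
      using q(1) by (simp add: t_def power2_eq_square field_simps)
    also have "\<dots> < 0" using pos q by simp
    finally show False by simp
  qed
  then have "r = (\<lambda>_. 0)" by (rule ip_eq_0[OF r])
  then have "T g = (\<lambda>x. m * g x)" by (simp add: r_def fun_eq_iff)
  moreover have "g \<noteq> (\<lambda>_. 0)" using g(2) by (auto simp: ip_def)
  ultimately have "m \<in> spectrum_on Z T" using g(1) by (auto simp: spectrum_on_def)
  then have "Min (spectrum_on Z T) \<le> m" by (rule Min_le[OF finite_spectrum])
  then have "Min (spectrum_on Z T) * ip f f \<le> m * ip f f"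
    by (rule mult_right_mono[OF _ ip_nonneg])
  then show ?thesis using le[OF f(1)] by simp
qed

end


section \<open>Alternating functions on lists\<close>

text \<open>Adjacent swaps suffice since they generate all permutations. The condition ranges over
  lists of all lengths, so prefixing or appending entries preserves it.\<close>

definition alternating :: "('b list \<Rightarrow> real) \<Rightarrow> bool" where
  "alternating g \<longleftrightarrow> (\<forall>as x y bs. g (as @ x # y # bs) = - g (as @ y # x # bs))"

definition list_coboundary :: "('b list \<Rightarrow> real) \<Rightarrow> 'b list \<Rightarrow> real" where
  "list_coboundary g xs = (\<Sum>i<length xs. (- 1) ^ i * g (take i xs @ drop (Suc i) xs))"

lemma alternatingD: "alternating g \<Longrightarrow> g (as @ x # y # bs) = - g (as @ y # x # bs)"
  unfolding alternating_def by blast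

lemma alternating_move:
  assumes "alternating g"
  shows "g (as @ xs @ x # bs) = (- 1) ^ length xs * g (as @ x # xs @ bs)"
proof (induction xs arbitrary: as)
  case (Cons y xs)
  have "g (as @ (y # xs) @ x # bs) = (- 1) ^ length xs * g (as @ y # x # xs @ bs)"
    using Cons[of "as @ [y]"] by simp
  also have "g (as @ y # x # xs @ bs) = - g (as @ x # y # xs @ bs)"
    by (rule alternatingD[OF assms])
  finally show ?case by simp
qed simp

lemma alternating_move_front:
  assumes "alternating g" "i < length xs"
  shows "g (xs ! i # take i xs @ drop (Suc i) xs) = (- 1) ^ i * g xs"
  using alternating_move[OF assms(1), of "[]" "take i xs" "xs ! i" "drop (Suc i) xs"]
    id_take_nth_drop[OF assms(2), symmetric] assms(2) by (simp add: min_def)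

text \<open>Bringing \<open>y\<close> next to \<open>x\<close>, swapping the two and taking
  \<open>x\<close> to the old place of \<open>y\<close> uses \<open>2 * length bs + 1\<close>
  adjacent swaps, an odd number.\<close>

lemma alternating_exchange:
  assumes "alternating g"
  shows "g (as @ x # bs @ y # cs) = - g (as @ y # bs @ x # cs)"
proof -
  have "g (as @ x # bs @ y # cs) = (- 1) ^ (length bs) * g (as @ x # y # bs @ cs)"
    using alternating_move[OF assms, of "as @ [x]" bs y cs] by simp
  also have "g (as @ x # y # bs @ cs) = - g (as @ y # x # bs @ cs)"
    by (rule alternatingD[OF assms])
  also have "g (as @ y # x # bs @ cs) = (- 1) ^ (length bs) * g (as @ y # bs @ x # cs)"
    using alternating_move[OF assms, of "as @ [y]" bs x cs]
    by simp
  finally show ?thesis by simp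
qed

lemma alternating_not_distinct:
  assumes "alternating g" "\<not> distinct xs"
  shows "g xs = 0"
proof -
  obtain as x bs cs where "xs = as @ [x] @ bs @ [x] @ cs"
    using not_distinct_decomp[OF assms(2)] by blast
  then show ?thesis using alternating_exchange[OF assms(1), of as x bs x cs] by simp
qed

section \<open>Permutations acting on alternating functions\<close>

lemma permute_list_transpose:
  assumes "a < b" "b < length xs"
  shows "\<exists>as x bs y cs. xs = as @ x # bs @ y # cs \<and>
    permute_list (Transposition.transpose a b) xs = as @ y # bs @ x # cs"
proof -
  define ys where "ys = drop (Suc a) xs"
  define k where "k = b - Suc a"
  have xs: "xs = take a xs @ xs ! a # ys"
    using assms by (simp add: ys_def id_take_nth_drop[symmetric])
  have ys: "ys = take k ys @ ys ! k # drop (Suc k) ys"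
    using assms by (intro id_take_nth_drop) (auto simp: ys_def k_def)
  define as bs cs x y where defs: "as = take a xs" "bs = take k ys" "cs = drop (Suc k) ys"
    "x = xs ! a" "y = ys ! k"
  have eq: "xs = as @ x # bs @ y # cs" using xs ys by (simp add: defs)
  have a: "a = length as" using assms by (simp add: defs)
  have b: "b = Suc (length as + length bs)" using assms by (auto simp: defs ys_def k_def)
  have "permute_list (Transposition.transpose a b) xs = as @ y # bs @ x # cs"
  proof (rule nth_equalityI)
    fix i assume "i < length (permute_list (Transposition.transpose a b) xs)"
    then have i: "i < length xs" by simp
    have "Transposition.transpose a b permutes {..<length xs}"
      using assms by (intro permutes_swap_id) auto
    then have "permute_list (Transposition.transpose a b) xs ! i = xs ! Transposition.transpose a b i"
      using i by (rule permute_list_nth)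
    also have "\<dots> = (as @ y # bs @ x # cs) ! i"
      unfolding eq a b Transposition.transpose_def
      by (auto simp: nth_append nth_Cons split: nat.splits)
    finally show "permute_list (Transposition.transpose a b) xs ! i = (as @ y # bs @ x # cs) ! i" .
  qed (simp add: eq)
  then show ?thesis using eq by blast
qed

lemma permute_list_adjacent_transpose:
  "permute_list (Transposition.transpose (length as) (Suc (length as))) (as @ x # y # bs) = as @ y # x # bs"
proof (rule nth_equalityI)
  let ?t = "Transposition.transpose (length as) (Suc (length as))"
  fix i assume "i < length (permute_list ?t (as @ x # y # bs))"
  then have i: "i < length (as @ x # y # bs)" by simp
  have "?t permutes {..<length (as @ x # y # bs)}"
    by (intro permutes_swap_id) auto
  then have "permute_list ?t (as @ x # y # bs) ! i = (as @ x # y # bs) ! ?t i"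
    using i by (rule permute_list_nth)
  also have "\<dots> = (as @ y # x # bs) ! i"
    by (auto simp: nth_append nth_Cons Transposition.transpose_def split: nat.splits)
  finally show "permute_list ?t (as @ x # y # bs) ! i = (as @ y # x # bs) ! i" .
qed simp

lemma alternating_permute:
  assumes g: "alternating g" and p: "p permutes {..<length xs}"
  shows "g (permute_list p xs) = of_int (sign p) * g xs"
proof -
  \<comment> \<open>The list is generalized because \<open>permute_list (?t \<circ> p) ys\<close>
    applies \<open>p\<close> to the already transposed list, where the induction hypothesis is
    needed.\<close>
  have "\<forall>ys. length ys = length xs \<longrightarrow> g (permute_list p ys) = of_int (sign p) * g ys"
    using p finite_lessThan
  proof (induction rule: permutes_induct)
    case (swap a b p)
    let ?t = "Transposition.transpose a b"
    have t: "?t permutes {..<length xs}" using swap by (intro permutes_swap_id) auto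
    have "sign (?t \<circ> p) = - sign p"
      using swap.hyps(3) permutes_imp_permutation[OF finite_lessThan swap.hyps(4)]
      by (simp add: sign_compose permutation_swap_id sign_swap_id)
    moreover have "g (permute_list (?t \<circ> p) ys) = - of_int (sign p) * g ys" if "length ys = length xs" for ys
    proof -
      have "permute_list (?t \<circ> p) ys = permute_list p (permute_list ?t ys)"
        using swap that by (intro permute_list_compose) auto
      moreover have "g (permute_list ?t ys) = - g ys"
      proof -
        have *: "g (permute_list (Transposition.transpose a b) ys) = - g ys"
          if ab: "a < b" "b < length ys" for a b
        proof -
          obtain as x bs y cs where "ys = as @ x # bs @ y # cs"
            "permute_list (Transposition.transpose a b) ys = as @ y # bs @ x # cs"
            using permute_list_transpose[OF ab] by blast
          then show ?thesis using alternating_exchange[OF g, of as y bs x cs] by metis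
        qed
        show ?thesis
          using *[of a b] *[of b a] swap.hyps(1-3) that by (cases "a < b") (simp_all add: transpose_commute)
      qed
      ultimately show ?thesis using swap that by simp
    qed
    ultimately show ?case by (simp add: comp_def)
  qed simp
  then show ?thesis by simp
qed

text \<open>Deleting an entry other than \<open>x\<close> and \<open>y\<close> leaves an adjacent
  swap to which \<open>g\<close> responds with a sign. The two terms deleting \<open>x\<close> or
  \<open>y\<close> trade places, and their positions differ by one, so their signs are
  opposite.\<close>

lemma alternating_list_coboundary:
  assumes "alternating g"
  shows "alternating (list_coboundary g)"
  unfolding alternating_def
proof (intro allI)
  fix as :: "'a list" and x y bs
  define n where "n = length (as @ x # y # bs)"
  define k where "k = length as"
  define t where "t zs i = (- 1) ^ i * g (take i zs @ drop (Suc i) zs)" for zs i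
  have k: "k \<in> {..<n}" "Suc k \<in> {..<n} - {k}" by (auto simp: n_def k_def)
  have split: "(\<Sum>i<n. t zs i) = t zs k + t zs (Suc k) + (\<Sum>i\<in>{..<n} - {k} - {Suc k}. t zs i)" for zs
    using k by (simp add: sum.remove[of _ k] sum.remove[of _ "Suc k"])
  have "t (as @ x # y # bs) i = - t (as @ y # x # bs) i" if "i \<in> {..<n} - {k} - {Suc k}" for i
  proof (cases "i < k")
    case True
    then have "take i (as @ u # v # bs) @ drop (Suc i) (as @ u # v # bs)
       = (take i as @ drop (Suc i) as) @ u # v # bs" for u v
      by (simp add: k_def)
    then show ?thesis
      using alternatingD[OF assms, of "take i as @ drop (Suc i) as" x y bs]
      by (simp only: t_def)
  next
    case False
    define j where "j = i - Suc (Suc k)"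
    have i: "i = k + Suc (Suc j)" using False that by (auto simp: j_def)
    have "take i (as @ u # v # bs) @ drop (Suc i) (as @ u # v # bs)
       = as @ u # v # (take j bs @ drop (Suc j) bs)" for u v
      by (simp add: k_def i numeral_3_eq_3)
    then show ?thesis
      using alternatingD[OF assms, of as x y "take j bs @ drop (Suc j) bs"]
      by (simp only: t_def)
  qed
  moreover have "t (as @ x # y # bs) k = - t (as @ y # x # bs) (Suc k)"
    "t (as @ x # y # bs) (Suc k) = - t (as @ y # x # bs) k"
    by (simp_all add: t_def k_def)
  ultimately have "(\<Sum>i<n. t (as @ x # y # bs) i) = - (\<Sum>i<n. t (as @ y # x # bs) i)"
    unfolding split by (simp add: sum_negf)
  then show "list_coboundary g (as @ x # y # bs) = - list_coboundary g (as @ y # x # bs)"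
    by (simp add: list_coboundary_def n_def t_def)
qed

section \<open>Sums over all vertex lists, repetitions included\<close>

abbreviation lists_of :: "'a set \<Rightarrow> nat \<Rightarrow> 'a list set" where
  "lists_of V m \<equiv> {xs. set xs \<subseteq> V \<and> length xs = m}"

lemma sum_lists_of_Suc:
  "(\<Sum>ys\<in>lists_of V (Suc m). h ys) = (\<Sum>xs\<in>lists_of V m. \<Sum>v\<in>V. h (v # xs))"
proof -
  have "(\<Sum>ys\<in>lists_of V (Suc m). h ys) = (\<Sum>(xs, v)\<in>lists_of V m \<times> V. h (v # xs))"
  proof -
    have "inj_on (\<lambda>(xs, v). v # xs) (lists_of V m \<times> V)" by (rule inj_onI) (clarsimp split: prod.splits)
    then show ?thesis unfolding lists_length_Suc_eq by (simp add: sum.reindex case_prod_unfold)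
  qed
  then show ?thesis by (simp add: sum.cartesian_product)
qed

lemma sum_lists_of_move_front:
  assumes "i \<le> m"
  shows "(\<Sum>ys\<in>lists_of V (Suc m). h (ys ! i # take i ys @ drop (Suc i) ys)) = (\<Sum>ys\<in>lists_of V (Suc m). h ys)"
proof (rule sum.reindex_bij_witness[where j = "\<lambda>ys. ys ! i # take i ys @ drop (Suc i) ys"
      and i = "\<lambda>zs. take i (tl zs) @ hd zs # drop i (tl zs)"])
  fix ys assume "ys \<in> lists_of V (Suc m)"
  then have ys: "i < length ys" "set ys \<subseteq> V" "length ys = Suc m" using assms by auto
  show "take i (tl (ys ! i # take i ys @ drop (Suc i) ys)) @ hd (ys ! i # take i ys @ drop (Suc i) ys) #
      drop i (tl (ys ! i # take i ys @ drop (Suc i) ys)) = ys"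
    using ys by (simp add: id_take_nth_drop[symmetric])
  show "ys ! i # take i ys @ drop (Suc i) ys \<in> lists_of V (Suc m)"
    using ys by (auto simp: dest!: in_set_takeD in_set_dropD)
next
  fix zs assume "zs \<in> lists_of V (Suc m)"
  then have zs: "set zs \<subseteq> V" "length zs = Suc m" by auto
  then obtain v xs where v: "zs = v # xs" "length xs = m" by (auto simp: length_Suc_conv)
  show "take i (tl zs) @ hd zs # drop i (tl zs) \<in> lists_of V (Suc m)"
    using zs v by (auto simp: dest!: in_set_takeD in_set_dropD)
  show "(take i (tl zs) @ hd zs # drop i (tl zs)) ! i # take i (take i (tl zs) @ hd zs # drop i (tl zs)) @
      drop (Suc i) (take i (tl zs) @ hd zs # drop i (tl zs)) = zs"
    using v assms by (simp add: nth_append)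
qed simp

text \<open>Adjointness of boundary and coboundary at the level of lists. Moving the deleted entry
  to the front changes \<open>g\<close> by \<open>(-1) ^ i\<close>, which cancels the sign in the
  coboundary, so all \<open>Suc m\<close> positions contribute equally.\<close>

lemma sum_lists_of_coboundary:
  assumes "alternating g"
  shows "(\<Sum>ys\<in>lists_of V (Suc m). g ys * list_coboundary f ys)
    = real (Suc m) * (\<Sum>xs\<in>lists_of V m. (\<Sum>v\<in>V. g (v # xs)) * f xs)"
proof -
  have "(\<Sum>ys\<in>lists_of V (Suc m). g ys * list_coboundary f ys)
     = (\<Sum>ys\<in>lists_of V (Suc m). \<Sum>i<Suc m. g ys * ((- 1) ^ i * f (take i ys @ drop (Suc i) ys)))"
    by (intro sum.cong refl) (simp add: list_coboundary_def sum_distrib_left del: sum.lessThan_Suc)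
  also have "\<dots> = (\<Sum>i<Suc m. \<Sum>ys\<in>lists_of V (Suc m). g ys * ((- 1) ^ i * f (take i ys @ drop (Suc i) ys)))"
    by (rule sum.swap)
  also have "\<dots> = (\<Sum>i<Suc m. \<Sum>ys\<in>lists_of V (Suc m). g ys * f (tl ys))"
  proof (rule sum.cong[OF refl])
    fix i assume i: "i \<in> {..<Suc m}"
    have "(\<Sum>ys\<in>lists_of V (Suc m). g ys * ((- 1) ^ i * f (take i ys @ drop (Suc i) ys)))
      = (\<Sum>ys\<in>lists_of V (Suc m). (\<lambda>zs. g zs * f (tl zs)) (ys ! i # take i ys @ drop (Suc i) ys))"
      using i by (intro sum.cong refl) (auto simp: alternating_move_front[OF assms])
    also have "\<dots> = (\<Sum>ys\<in>lists_of V (Suc m). g ys * f (tl ys))"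
      using i by (intro sum_lists_of_move_front) auto
    finally show "(\<Sum>ys\<in>lists_of V (Suc m). g ys * ((- 1) ^ i * f (take i ys @ drop (Suc i) ys)))
      = (\<Sum>ys\<in>lists_of V (Suc m). g ys * f (tl ys))" .
  qed
  also have "\<dots> = real (Suc m) * (\<Sum>ys\<in>lists_of V (Suc m). g ys * f (tl ys))" by simp
  also have "(\<Sum>ys\<in>lists_of V (Suc m). g ys * f (tl ys)) = (\<Sum>xs\<in>lists_of V m. (\<Sum>v\<in>V. g (v # xs)) * f xs)"
    by (simp add: sum_lists_of_Suc sum_distrib_right)
  finally show ?thesis .
qed

text \<open>The Levi-Civita symbol, as the sign of the Vandermonde product.\<close>

fun vandermonde_sign :: "nat list \<Rightarrow> real" where
  "vandermonde_sign [] = 1"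
| "vandermonde_sign (c # cs) = (\<Prod>x\<leftarrow>cs. sgn (real x - real c)) * vandermonde_sign cs"

text \<open>A swap reorders the factors of the product and negates only the one comparing
  \<open>x\<close> with \<open>y\<close>; for \<open>x = y\<close> that factor is
  \<open>0\<close>.\<close>

lemma alternating_vandermonde_sign: "alternating vandermonde_sign"
proof -
  have "vandermonde_sign (as @ x # y # bs) = - vandermonde_sign (as @ y # x # bs)" for as x y bs
  proof (induction as)
    case Nil
    have "sgn (real y - real x) = - sgn (real x - real y)" by (simp add: sgn_if)
    then show ?case by simp
  qed simp
  then show ?thesis unfolding alternating_def by blast
qed

lemma vandermonde_sign_square:
  "vandermonde_sign cs * vandermonde_sign cs = (if distinct cs then 1 else 0)"
proof (cases "distinct cs")
  case True
  then have "\<bar>vandermonde_sign cs\<bar> = 1"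
  proof (induction cs)
    case (Cons c cs)
    have "\<bar>\<Prod>x\<leftarrow>cs. sgn (real x - real c)\<bar> = 1" if "c \<notin> set cs"
      using that by (induction cs) (auto simp: abs_mult sgn_if)
    then show ?case using Cons by (simp add: abs_mult)
  qed simp
  then show ?thesis using True abs_mult_self_eq[of "vandermonde_sign cs"] by simp
qed (simp add: alternating_not_distinct[OF alternating_vandermonde_sign])


section \<open>Forms as alternating functions\<close>

lemma orient_self: "xs \<in> orient xs"
  unfolding orient_def by (rule CollectI, rule exI[of _ id]) (simp add: permutes_id)

text \<open>The class of a permuted list consists of the orderings with the parity of
  \<open>p\<close>. This one description yields both the invariance under even permutations and the
  formula for \<open>opposite\<close>.\<close>

lemma orient_permute_list:
  assumes p: "p permutes {..<length xs}"
  shows "orient (permute_list p xs) = {permute_list q xs | q. q permutes {..<length xs} \<and> evenperm q = evenperm p}"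
proof (intro equalityI subsetI)
  fix zs assume "zs \<in> orient (permute_list p xs)"
  then obtain q where q: "q permutes {..<length xs}" "evenperm q" "zs = permute_list q (permute_list p xs)"
    by (auto simp: orient_def)
  have "zs = permute_list (p \<circ> q) xs" using q by (simp add: permute_list_compose)
  moreover have "evenperm (p \<circ> q) = evenperm p"
    using q p by (simp add: evenperm_comp permutes_imp_permutation[OF finite_lessThan])
  ultimately show "zs \<in> {permute_list q xs | q. q permutes {..<length xs} \<and> evenperm q = evenperm p}"
    using permutes_compose[OF q(1) p] by blast
next
  fix zs assume "zs \<in> {permute_list q xs | q. q permutes {..<length xs} \<and> evenperm q = evenperm p}"
  then obtain q where q: "q permutes {..<length xs}" "evenperm q = evenperm p" "zs = permute_list q xs"
    by blast
  \<comment> \<open>\<open>permute_list\<close> composes in reverse order, so the permutation taking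
    \<open>permute_list p xs\<close> to \<open>permute_list q xs\<close> is
    \<open>inv p \<circ> q\<close>.\<close>
  define r where "r = inv p \<circ> q"
  have r: "r permutes {..<length xs}"
    unfolding r_def by (rule permutes_compose[OF q(1) permutes_inv[OF p]])
  have "p \<circ> r = q" unfolding r_def by (simp add: fun_eq_iff permutes_inverses[OF p])
  then have "zs = permute_list r (permute_list p xs)"
    using q(3) permute_list_compose[OF r, of p] by simp
  moreover have "evenperm r"
    unfolding r_def using q p permutes_inv[OF p]
    by (simp add: evenperm_comp evenperm_inv permutes_imp_permutation[OF finite_lessThan])
  ultimately show "zs \<in> orient (permute_list p xs)"
    using r by (auto simp: orient_def)
qed

lemma orient_permute_even:
  assumes "p permutes {..<length xs}" "evenperm p"
  shows "orient (permute_list p xs) = orient xs"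
  unfolding orient_permute_list[OF assms(1)] using assms(2) by (simp add: orient_def)

lemma opposite_orient:
  assumes p: "p permutes {..<length xs}" "\<not> evenperm p"
  shows "opposite (orient xs) = orient (permute_list p xs)"
proof -
  have "opposite (orient xs) = {permute_list q xs | q. q permutes {..<length xs} \<and> \<not> evenperm q}"
  proof (intro equalityI subsetI)
    fix zs assume "zs \<in> opposite (orient xs)"
    then obtain q r where q: "r permutes {..<length xs}" "evenperm r" "q permutes {..<length xs}" "\<not> evenperm q"
      "zs = permute_list q (permute_list r xs)"
      by (auto simp: opposite_def orient_def)
    have "zs = permute_list (r \<circ> q) xs" using q by (simp add: permute_list_compose)
    moreover have "\<not> evenperm (r \<circ> q)"
      using q by (simp add: evenperm_comp permutes_imp_permutation[OF finite_lessThan])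
    ultimately show "zs \<in> {permute_list q xs | q. q permutes {..<length xs} \<and> \<not> evenperm q}"
      using permutes_compose[OF q(3) q(1)] by blast
  next
    fix zs assume "zs \<in> {permute_list q xs | q. q permutes {..<length xs} \<and> \<not> evenperm q}"
    then show "zs \<in> opposite (orient xs)"
      unfolding opposite_def using orient_self by blast
  qed
  then show ?thesis unfolding orient_permute_list[OF p(1)] using p(2) by simp
qed

lemma opposite_orient_swap:
  "opposite (orient (as @ x # y # bs)) = orient (as @ y # x # bs)"
  by (subst opposite_orient[where p = "Transposition.transpose (length as) (Suc (length as))"])
    (auto intro!: permutes_swap_id simp: evenperm_swap permute_list_adjacent_transpose)

lemma orient_memD:
  assumes "ys \<in> orient xs"
  shows "set ys = set xs" "distinct ys = distinct xs" "length ys = length xs"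
  using assms by (auto simp: orient_def)

lemma orient_in_oriented_cells:
  "orient xs \<in> oriented_cells X j \<longleftrightarrow> distinct xs \<and> set xs \<in> cells X j"
proof
  assume "orient xs \<in> oriented_cells X j"
  then obtain ys where "distinct ys" "set ys \<in> cells X j" "orient xs = orient ys"
    by (auto simp: oriented_cells_def)
  then show "distinct xs \<and> set xs \<in> cells X j"
    using orient_self[of xs] orient_memD[of xs ys] by simp
qed (auto simp: oriented_cells_def)

lemma oriented_cellsE:
  assumes "\<sigma> \<in> oriented_cells X j"
  obtains xs where "\<sigma> = orient xs" "distinct xs" "set xs \<in> cells X j" "int (length xs) = j + 1"
proof -
  obtain xs where xs: "\<sigma> = orient xs" "distinct xs" "set xs \<in> cells X j"
    using assms unfolding oriented_cells_def by blast
  moreover from xs have "int (length xs) = j + 1"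
    by (simp add: cells_def cell_dim_def distinct_card)
  ultimately show thesis by (rule that)
qed

lemma underlying_cell_orient: "underlying_cell (orient xs) = set xs"
  unfolding underlying_cell_def using orient_memD(1) orient_self by fastforce

text \<open>An even permutation of the positions of \<open>xs\<close>, shifted by one and fixing
  position \<open>0\<close>, is an even permutation of the positions of \<open>v # xs\<close>; hence
  all sets in the union defining \<open>cone\<close> coincide.\<close>

lemma cone_orient: "cone v (orient xs) = orient (v # xs)"
proof -
  have "orient (v # ys) = orient (v # xs)" if ys: "ys \<in> orient xs" for ys
  proof -
    obtain p where p: "p permutes {..<length xs}" "evenperm p" "ys = permute_list p xs"
      using ys by (auto simp: orient_def)
    define q where "q = map_permutation {..<length xs} Suc p"
    have inj: "inj_on Suc {..<length xs}" by simp
    have "q permutes Suc ` {..<length xs}"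
      unfolding q_def by (rule map_permutation_permutes) (use p inj in \<open>auto simp: bij_betw_def\<close>)
    then have q: "q permutes {..<length (v # xs)}"
      by (rule permutes_subset) auto
    have "evenperm q" unfolding q_def using p inj by (subst evenperm_map_permutation) auto
    moreover have "v # ys = permute_list q (v # xs)"
    proof (rule nth_equalityI)
      fix i assume i: "i < length (v # ys)"
      then have "permute_list q (v # xs) ! i = (v # xs) ! q i"
        using p by (intro permute_list_nth[OF q]) simp
      also have "\<dots> = (v # ys) ! i"
      proof (cases i)
        case 0
        then have "q i = 0" by (auto simp: q_def map_permutation_def restrict_id_def)
        then show ?thesis using 0 by simp
      next
        case (Suc k)
        then have "k < length xs" using i p by simp
        moreover have "inv_into {..<length xs} Suc (Suc k) = k"
          using \<open>k < length xs\<close> by (intro inv_into_f_f) auto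
        ultimately have "q i = Suc (p k)"
          using Suc by (auto simp: q_def map_permutation_def restrict_id_def)
        then show ?thesis using Suc p \<open>k < length xs\<close> by (simp add: permute_list_nth)
      qed
      finally show "(v # ys) ! i = permute_list q (v # xs) ! i" by simp
    qed (simp add: p)
    ultimately show ?thesis using orient_permute_even[OF q] by simp
  qed
  then show ?thesis unfolding cone_def using orient_self by blast
qed

text \<open>Representatives of an oriented cell differ by even permutations, which alternating
  functions do not see. This frees \<open>coboundary\<close>, and later the test form, from the
  chosen representative.\<close>

lemma alternating_orient_SOME:
  assumes "alternating g"
  shows "g (SOME ys. ys \<in> orient xs) = g xs"
proof -
  have "(SOME ys. ys \<in> orient xs) \<in> orient xs" using orient_self by (rule someI)
  then obtain p where "p permutes {..<length xs}" "evenperm p" "(SOME ys. ys \<in> orient xs) = permute_list p xs"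
    unfolding orient_def by blast
  then show ?thesis
    using alternating_permute[OF assms, of p xs] by (simp add: sign_def)
qed

text \<open>Turns antisymmetry under \<open>opposite\<close> into alternation on lists. The case
  \<open>j = 0\<close>, where \<open>forms\<close> imposes no antisymmetry, is consistent: a list
  with two entries to swap does not order a 0-cell, so both values are \<open>0\<close>.\<close>

lemma forms_iff:
  fixes f :: "'a list set \<Rightarrow> real"
  assumes "j \<ge> 0"
  shows "f \<in> forms X j \<longleftrightarrow> (\<forall>\<sigma>. \<sigma> \<notin> oriented_cells X j \<longrightarrow> f \<sigma> = 0) \<and> alternating (\<lambda>xs. f (orient xs))"
proof (intro iffI conjI)
  assume f: "f \<in> forms X j"
  then show "\<forall>\<sigma>. \<sigma> \<notin> oriented_cells X j \<longrightarrow> f \<sigma> = 0" by (auto simp: forms_def)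
  show "alternating (\<lambda>xs. f (orient xs))"
    unfolding alternating_def
  proof (intro allI)
    fix as bs :: "'a list" and x y
    let ?xs = "as @ x # y # bs" and ?ys = "as @ y # x # bs"
    show "f (orient ?xs) = - f (orient ?ys)"
    proof (cases "orient ?xs \<in> oriented_cells X j")
      case True
      then have "set ?xs \<in> cells X j" "distinct ?xs" by (auto simp only: orient_in_oriented_cells)
      then have "int (length ?xs) = j + 1"
        by (simp only: cells_def cell_dim_def distinct_card mem_Collect_eq) simp
      then have "j \<ge> 1" by simp
      then have "f (opposite (orient ?xs)) = - f (orient ?xs)" using f True by (auto simp: forms_def)
      then show ?thesis by (simp add: opposite_orient_swap)
    next
      case False
      then have "orient ?ys \<notin> oriented_cells X j"
        by (auto simp: orient_in_oriented_cells insert_commute)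
      then show ?thesis using False f by (simp add: forms_def)
    qed
  qed
next
  assume f: "(\<forall>\<sigma>. \<sigma> \<notin> oriented_cells X j \<longrightarrow> f \<sigma> = 0) \<and> alternating (\<lambda>xs. f (orient xs))"
  have "f (opposite \<sigma>) = - f \<sigma>" if j1: "j \<ge> 1" and \<sigma>: "\<sigma> \<in> oriented_cells X j" for \<sigma>
  proof -
    obtain xs where xs: "\<sigma> = orient xs" "int (length xs) = j + 1"
      using \<sigma> by (elim oriented_cellsE) blast
    then have "length xs \<ge> 2" using j1 by simp
    then obtain x y bs where "xs = x # y # bs"
      by (metis Suc_le_length_iff numeral_2_eq_2)
    then show ?thesis
      using xs opposite_orient_swap[of "[]" x y bs] alternatingD[OF conjunct2[OF f], of "[]" y x bs] by simp
  qed
  then show "f \<in> forms X j" using f by (auto simp: forms_def)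
qed

lemma antisymmetric_sum_eq_0:
  fixes h :: "'a \<Rightarrow> 'a \<Rightarrow> real"
  assumes "\<And>u v. h u v = - h v u"
  shows "(\<Sum>u\<in>V. \<Sum>v\<in>V. h u v) = 0"
proof -
  have "(\<Sum>u\<in>V. \<Sum>v\<in>V. h u v) = (\<Sum>u\<in>V. \<Sum>v\<in>V. - h v u)"
    using assms by (intro sum.cong refl) blast
  also have "\<dots> = - (\<Sum>u\<in>V. \<Sum>v\<in>V. h u v)"
    by (subst sum.swap) (simp add: sum_negf)
  finally show ?thesis by simp
qed

section \<open>Linearity and continuity of the operators\<close>

lemma boundary_lincomb:
  "boundary X j (\<lambda>x. f x + c * g x) = (\<lambda>x. boundary X j f x + c * boundary X j g x)"
  by (simp add: boundary_def fun_eq_iff sum.distrib sum_distrib_left)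

lemma coboundary_lincomb:
  "coboundary X j (\<lambda>x. f x + c * g x) = (\<lambda>x. coboundary X j f x + c * coboundary X j g x)"
  by (simp add: coboundary_def fun_eq_iff Let_def sum.distrib sum_distrib_left algebra_simps)

lemma continuous_boundary:
  assumes "\<And>x. continuous_on UNIV (\<lambda>f. F f x)"
  shows "continuous_on UNIV (\<lambda>f. boundary X j (F f) \<sigma>)"
  unfolding boundary_def by (cases "\<sigma> \<in> oriented_cells X (j - 1)") (auto intro!: continuous_intros assms)

lemma continuous_coboundary:
  "continuous_on UNIV (\<lambda>f. coboundary X j f \<sigma>)"
  unfolding coboundary_def Let_def
  by (cases "\<sigma> \<in> oriented_cells X j") (auto intro!: continuous_intros)

text \<open>All defining conditions are equations between functions of \<open>f\<close> that are
  continuous for pointwise convergence.\<close>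

lemma closed_cycles: "closed (cycles X j)"
proof -
  have eval: "continuous_on UNIV (\<lambda>f::'a list set \<Rightarrow> real. f x)" for x by simp
  have imp: "closed {f. P \<longrightarrow> Q f}" if "closed {f. Q f}" for P and Q :: "('a list set \<Rightarrow> real) \<Rightarrow> bool"
    using that by (cases P) auto
  have "closed {f. boundary X j f \<sigma> = 0}" for \<sigma>
    by (intro closed_Collect_eq continuous_boundary eval continuous_intros)
  then have "closed {f. \<forall>\<sigma>. boundary X j f \<sigma> = 0}" by (rule closed_Collect_all)
  moreover have "closed (forms X j)"
    unfolding forms_def Ball_def
    by (intro closed_Collect_conj closed_Collect_all imp closed_Collect_eq continuous_intros eval)
  ultimately show ?thesis
    by (auto simp: cycles_def fun_eq_iff Collect_conj_eq intro: closed_Int)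
qed

section \<open>Forms and operators on a finite complex\<close>

locale finite_complex =
  fixes V :: "'a set" and X :: "'a set set"
  assumes finite_V: "finite V" and cplx: "abstract_simplicial_complex V X"
begin

lemma cell_subset: "\<sigma> \<in> X \<Longrightarrow> \<sigma> \<subseteq> V"
  using cplx by (auto simp: abstract_simplicial_complex_def)

lemma face_in: "\<sigma> \<in> X \<Longrightarrow> \<tau> \<subseteq> \<sigma> \<Longrightarrow> \<tau> \<in> X"
  using cplx by (auto simp: abstract_simplicial_complex_def)

lemma oriented_cells_Cons:
  assumes "orient (v # xs) \<in> oriented_cells X j"
  shows "adjacent X v (orient xs)" "orient xs \<in> oriented_cells X (j - 1)"
  using assms face_in[of "insert v (set xs)" "set xs"]
  by (auto simp: orient_in_oriented_cells adjacent_def underlying_cell_orient cells_def cell_dim_def)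

text \<open>Since \<open>f\<close> vanishes off the cells, the sum may run over all of
  \<open>V\<close>. If \<open>xs\<close> orders no cell, then neither does any
  \<open>v # xs\<close>, so the default value \<open>0\<close> fits the same formula.\<close>

lemma boundary_orient:
  assumes "\<And>\<sigma>. \<sigma> \<notin> oriented_cells X j \<Longrightarrow> f \<sigma> = 0"
  shows "boundary X j f (orient xs) = (\<Sum>v\<in>V. f (orient (v # xs)))"
proof (cases "orient xs \<in> oriented_cells X (j - 1)")
  case True
  have "(\<Sum>v\<in>V. f (orient (v # xs))) = (\<Sum>v | adjacent X v (orient xs). f (orient (v # xs)))"
  proof (rule sum.mono_neutral_right[OF finite_V])
    show "{v. adjacent X v (orient xs)} \<subseteq> V"
      using cell_subset by (auto simp: adjacent_def)
    show "\<forall>v\<in>V - {v. adjacent X v (orient xs)}. f (orient (v # xs)) = 0"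
      using oriented_cells_Cons(1) assms by blast
  qed
  then show ?thesis using True by (simp add: boundary_def cone_orient)
next
  case False
  then have "f (orient (v # xs)) = 0" for v using oriented_cells_Cons(2) assms by blast
  then show ?thesis using False by (simp add: boundary_def)
qed

lemma boundary_in_forms:
  assumes f: "f \<in> forms X j" and j: "j \<ge> 1"
  shows "boundary X j f \<in> forms X (j - 1)"
proof -
  have f0: "\<And>\<sigma>. \<sigma> \<notin> oriented_cells X j \<Longrightarrow> f \<sigma> = 0" and alt: "alternating (\<lambda>xs. f (orient xs))"
    using forms_iff[of j f X] f j by auto
  have "alternating (\<lambda>xs. boundary X j f (orient xs))"
    unfolding alternating_def
  proof (intro allI)
    fix as x y bs
    have "f (orient (v # as @ x # y # bs)) = - f (orient (v # as @ y # x # bs))" for v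
      using alternatingD[OF alt, of "v # as" x y bs] by simp
    moreover have "boundary X j f (orient xs) = (\<Sum>v\<in>V. f (orient (v # xs)))" for xs
      by (rule boundary_orient) (rule f0)
    ultimately show "boundary X j f (orient (as @ x # y # bs)) = - boundary X j f (orient (as @ y # x # bs))"
      by (simp add: sum_negf)
  qed
  moreover have "\<forall>\<sigma>. \<sigma> \<notin> oriented_cells X (j - 1) \<longrightarrow> boundary X j f \<sigma> = 0"
    by (simp add: boundary_def)
  ultimately show ?thesis using j by (subst forms_iff) auto
qed

text \<open>The double sum over \<open>u\<close> and \<open>v\<close> is antisymmetric in the two
  vertices. This places the image of the upper Laplacian in the cycles.\<close>

lemma boundary_boundary:
  assumes f: "f \<in> forms X j" and j: "j \<ge> 1"
  shows "boundary X (j - 1) (boundary X j f) = (\<lambda>_. 0)"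
proof
  fix \<sigma>
  have f0: "\<And>\<sigma>. \<sigma> \<notin> oriented_cells X j \<Longrightarrow> f \<sigma> = 0" and alt: "alternating (\<lambda>xs. f (orient xs))"
    using forms_iff[of j f X] f j by auto
  show "boundary X (j - 1) (boundary X j f) \<sigma> = 0"
  proof (cases "\<sigma> \<in> oriented_cells X (j - 1 - 1)")
    case True
    then obtain xs where xs: "\<sigma> = orient xs" by (elim oriented_cellsE)
    have "boundary X (j - 1) (boundary X j f) (orient xs) = (\<Sum>v\<in>V. boundary X j f (orient (v # xs)))"
      by (rule boundary_orient) (simp add: boundary_def)
    also have "\<dots> = (\<Sum>v\<in>V. \<Sum>u\<in>V. f (orient (u # v # xs)))"
      by (simp add: boundary_orient[OF f0])
    also have "\<dots> = 0"
    proof (rule antisymmetric_sum_eq_0)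
      show "f (orient (u # v # xs)) = - f (orient (v # u # xs))" for v u
        using alternatingD[OF alt, of "[]" u v xs] unfolding append_Nil .
    qed
    finally show ?thesis by (simp add: xs)
  qed (simp add: boundary_def)
qed

lemma coboundary_orient:
  assumes "f \<in> forms X (j - 1)" "j \<ge> 1"
  shows "coboundary X j f (orient ys) =
    (if orient ys \<in> oriented_cells X j then list_coboundary (\<lambda>xs. f (orient xs)) ys else 0)"
proof -
  have "alternating (list_coboundary (\<lambda>xs. f (orient xs)))"
    using forms_iff[of "j - 1" f X] assms by (intro alternating_list_coboundary) auto
  from alternating_orient_SOME[OF this, of ys] show ?thesis
    by (simp add: coboundary_def list_coboundary_def Let_def)
qed

lemma coboundary_in_forms:
  assumes f: "f \<in> forms X (j - 1)" and j: "j \<ge> 1"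
  shows "coboundary X j f \<in> forms X j"
proof -
  have alt: "alternating (list_coboundary (\<lambda>xs. f (orient xs)))"
    using forms_iff[of "j - 1" f X] assms by (intro alternating_list_coboundary) auto
  have "alternating (\<lambda>ys. coboundary X j f (orient ys))"
    unfolding alternating_def
  proof (intro allI)
    fix as x y bs
    have "orient (as @ x # y # bs) \<in> oriented_cells X j \<longleftrightarrow> orient (as @ y # x # bs) \<in> oriented_cells X j"
      by (auto simp: orient_in_oriented_cells insert_commute)
    then show "coboundary X j f (orient (as @ x # y # bs)) = - coboundary X j f (orient (as @ y # x # bs))"
      unfolding coboundary_orient[OF assms] using alternatingD[OF alt, of as x y bs] by simp
  qed
  moreover have "\<forall>\<sigma>. \<sigma> \<notin> oriented_cells X j \<longrightarrow> coboundary X j f \<sigma> = 0"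
    by (simp add: coboundary_def)
  ultimately show ?thesis using j by (subst forms_iff) auto
qed

text \<open>The right side is symmetric in \<open>f\<close> and \<open>g\<close>, which gives
  self-adjointness of the upper Laplacian; with \<open>g = f\<close> it evaluates the numerator of
  the Rayleigh quotient.\<close>

lemma sum_boundary_coboundary:
  assumes f: "f \<in> forms X (int d - 1)" and g: "g \<in> forms X (int d - 1)" and d: "d \<ge> 1"
  shows "real (Suc d) * (\<Sum>xs\<in>lists_of V d. boundary X (int d) (coboundary X (int d) f) (orient xs) * g (orient xs))
    = (\<Sum>ys\<in>lists_of V (Suc d). coboundary X (int d) f (orient ys) * coboundary X (int d) g (orient ys))"
proof -
  have j: "int d \<ge> 1" using d by simp
  have c0: "\<And>\<sigma>. \<sigma> \<notin> oriented_cells X (int d) \<Longrightarrow> coboundary X (int d) f \<sigma> = 0"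
    by (simp add: coboundary_def)
  have alt: "alternating (\<lambda>ys. coboundary X (int d) f (orient ys))"
    using forms_iff[of "int d"] coboundary_in_forms[OF f j] by auto
  \<comment> \<open>One coboundary may be replaced by its unrestricted list version, as the other
    factor vanishes off the cells.\<close>
  have "(\<Sum>ys\<in>lists_of V (Suc d). coboundary X (int d) f (orient ys) * coboundary X (int d) g (orient ys))
    = (\<Sum>ys\<in>lists_of V (Suc d). coboundary X (int d) f (orient ys) * list_coboundary (\<lambda>xs. g (orient xs)) ys)"
    unfolding coboundary_orient[OF g j] using c0 by (intro sum.cong) auto
  also have "\<dots> = real (Suc d) *
      (\<Sum>xs\<in>lists_of V d. (\<Sum>v\<in>V. coboundary X (int d) f (orient (v # xs))) * g (orient xs))"
    by (rule sum_lists_of_coboundary[OF alt])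
  finally show ?thesis using boundary_orient[OF c0] by simp
qed

lemma symmetric_operator_upper_laplacian:
  assumes d: "complex_dim X = int d" "d \<ge> 1"
  shows "symmetric_operator (lists_of V d) orient (cycles X (complex_dim X - 1)) (upper_laplacian X)"
proof
  have j: "int d \<ge> 1" using d by simp
  note iff = forms_iff[of "int d - 1" _ X]
  show "finite (lists_of V d)" by (rule finite_lists_length_eq[OF finite_V])
  show "closed (cycles X (complex_dim X - 1))" by (rule closed_cycles)
  show "continuous_on UNIV (\<lambda>f. upper_laplacian X f x)" for x
    unfolding upper_laplacian_def by (rule continuous_boundary[OF continuous_coboundary])
  show "upper_laplacian X (\<lambda>x. f x + c * g x) = (\<lambda>x. upper_laplacian X f x + c * upper_laplacian X g x)" for f g c
    by (simp add: upper_laplacian_def coboundary_lincomb boundary_lincomb)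
  show "(\<lambda>x. f x + c * g x) \<in> cycles X (complex_dim X - 1)"
    if "f \<in> cycles X (complex_dim X - 1)" "g \<in> cycles X (complex_dim X - 1)" for f g c
    using that by (auto simp: cycles_def forms_def boundary_lincomb)
  show "f x = 0" if "f \<in> cycles X (complex_dim X - 1)" "x \<notin> orient ` lists_of V d" for f x
  proof -
    have "x \<notin> oriented_cells X (int d - 1)"
    proof
      assume "x \<in> oriented_cells X (int d - 1)"
      then obtain xs where "x = orient xs" "set xs \<in> X" "length xs = d"
        by (elim oriented_cellsE) (auto simp: cells_def)
      then show False using that(2) cell_subset by blast
    qed
    then show ?thesis using that(1) d by (auto simp: cycles_def forms_def)
  qed
  show "upper_laplacian X f \<in> cycles X (complex_dim X - 1)" if "f \<in> cycles X (complex_dim X - 1)" for f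
    using that d coboundary_in_forms[OF _ j, of f]
      boundary_in_forms[OF coboundary_in_forms[OF _ j] j, of f]
      boundary_boundary[OF coboundary_in_forms[OF _ j] j, of f]
    by (auto simp: cycles_def upper_laplacian_def)
  show "(\<Sum>xs\<in>lists_of V d. upper_laplacian X f (orient xs) * g (orient xs))
      = (\<Sum>xs\<in>lists_of V d. f (orient xs) * upper_laplacian X g (orient xs))"
    if "f \<in> cycles X (complex_dim X - 1)" "g \<in> cycles X (complex_dim X - 1)" for f g
  proof -
    have "f \<in> forms X (int d - 1)" "g \<in> forms X (int d - 1)" using that d by (auto simp: cycles_def)
    then have "real (Suc d) * (\<Sum>xs\<in>lists_of V d. upper_laplacian X f (orient xs) * g (orient xs))
      = real (Suc d) * (\<Sum>xs\<in>lists_of V d. upper_laplacian X g (orient xs) * f (orient xs))"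
      unfolding upper_laplacian_def d(1)
      using sum_boundary_coboundary[of f d g] sum_boundary_coboundary[of g d f] d(2)
      by (simp only: mult.commute)
    then show ?thesis by (simp add: mult.commute)
  qed
qed

end


section \<open>The test form of a partition\<close>

locale coloring =
  fixes V :: "'a set" and d :: nat and A :: "nat \<Rightarrow> 'a set"
  assumes finV: "finite V" and part: "is_partition V d A"
begin

section \<open>Colors and transversals of a partition\<close>

definition color :: "'a \<Rightarrow> nat" where
  "color v = (THE i. i \<le> d \<and> v \<in> A i)"

lemma A_subset: "i \<le> d \<Longrightarrow> A i \<subseteq> V"
  using part by (auto simp: is_partition_def)

lemma color_eq:
  assumes "i \<le> d" "v \<in> A i"
  shows "color v = i"
  unfolding color_def
proof (rule the_equality)
  show "j = i" if "j \<le> d \<and> v \<in> A j" for j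
    using part that assms unfolding is_partition_def disjoint_family_on_def by blast
qed (use assms in simp)

lemma color:
  assumes "v \<in> V"
  shows "color v \<le> d" "v \<in> A (color v)"
proof -
  obtain i where "i \<le> d" "v \<in> A i" using part assms unfolding is_partition_def by blast
  then show "color v \<le> d" "v \<in> A (color v)" using color_eq by auto
qed

lemma color_class: "i \<le> d \<Longrightarrow> {v \<in> V. color v = i} = A i"
  using color color_eq A_subset by blast

lemma sum_card_classes: "(\<Sum>i\<le>d. card (A i)) = card V"
proof -
  have "card (\<Union>i\<in>{..d}. A i) = (\<Sum>i\<le>d. card (A i))"
    using part A_subset finV unfolding is_partition_def disjoint_family_on_def
    by (intro card_UN_disjoint) (auto intro: finite_subset)
  then show ?thesis using part by (simp add: is_partition_def)
qed

lemma card_class_pos: "i \<le> d \<Longrightarrow> card (A i) > 0"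
  using part A_subset finV unfolding is_partition_def by (meson card_gt_0_iff finite_subset)

text \<open>All transversals of the partition, whether or not they are cells; those lying in
  \<open>X\<close> are the cells counted by the Cheeger quotient.\<close>

definition rainbow :: "'a set set" where
  "rainbow = {\<sigma>. \<sigma> \<subseteq> V \<and> (\<forall>i\<le>d. card (\<sigma> \<inter> A i) = 1)}"

text \<open>Transversals are the ranges of choice functions for the blocks, which reduces counting
  them to the cardinality of a product.\<close>

lemma rainbow_eq_image: "rainbow = (\<lambda>f. f ` {..d}) ` Pi\<^sub>E {..d} A"
proof (intro equalityI subsetI)
  fix \<sigma> assume \<sigma>: "\<sigma> \<in> rainbow"
  define f where "f = (\<lambda>i\<in>{..d}. the_elem (\<sigma> \<inter> A i))"
  have f: "\<sigma> \<inter> A i = {f i}" if "i \<le> d" for i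
  proof -
    have "card (\<sigma> \<inter> A i) = 1" using \<sigma> that by (simp add: rainbow_def)
    then obtain x where "\<sigma> \<inter> A i = {x}" by (rule card_1_singletonE)
    then show ?thesis using \<open>i \<le> d\<close> by (simp add: f_def)
  qed
  have "f \<in> Pi\<^sub>E {..d} A"
    using f by (intro PiE_I) (auto simp: f_def)
  moreover have "\<sigma> = f ` {..d}"
  proof
    show "\<sigma> \<subseteq> f ` {..d}"
    proof
      fix v assume "v \<in> \<sigma>"
      then have v: "v \<in> V" using \<sigma> by (auto simp: rainbow_def)
      have "v \<in> \<sigma> \<inter> A (color v)" using color[OF v] \<open>v \<in> \<sigma>\<close> by simp
      then have "v = f (color v)" using f[of "color v"] color(1)[OF v] by simp
      then show "v \<in> f ` {..d}" using color[OF v] by blast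
    qed
    show "f ` {..d} \<subseteq> \<sigma>" using f by auto
  qed
  ultimately show "\<sigma> \<in> (\<lambda>f. f ` {..d}) ` Pi\<^sub>E {..d} A" by blast
next
  fix \<sigma> assume "\<sigma> \<in> (\<lambda>f. f ` {..d}) ` Pi\<^sub>E {..d} A"
  then obtain f where f: "f \<in> Pi\<^sub>E {..d} A" "\<sigma> = f ` {..d}" by blast
  have fA: "f i \<in> A i" if "i \<le> d" for i using f that by auto
  have "\<sigma> \<inter> A i = {f i}" if "i \<le> d" for i
  proof (intro equalityI subsetI)
    fix v assume v: "v \<in> \<sigma> \<inter> A i"
    then obtain j where j: "j \<le> d" "v = f j" using f(2) by auto
    then have "i = j" using color_eq[OF that, of v] color_eq[OF j(1), of v] fA v by simp
    then show "v \<in> {f i}" using j by simp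
  qed (use fA that f(2) in auto)
  moreover have "\<sigma> \<subseteq> V" using fA A_subset f(2) by blast
  ultimately show "\<sigma> \<in> rainbow" by (simp add: rainbow_def)
qed

lemma card_rainbow: "card rainbow = (\<Prod>i\<le>d. card (A i))"
proof -
  have "inj_on (\<lambda>f. f ` {..d}) (Pi\<^sub>E {..d} A)"
  proof (rule inj_onI)
    fix f g assume fg: "f \<in> Pi\<^sub>E {..d} A" "g \<in> Pi\<^sub>E {..d} A" "f ` {..d} = g ` {..d}"
    show "f = g"
    proof (rule PiE_ext[OF fg(1,2)])
      fix i assume i: "i \<in> {..d}"
      then obtain j where j: "j \<in> {..d}" "f i = g j" using fg(3) by (metis imageE imageI)
      have "f i \<in> A i" "g j \<in> A j" using fg(1,2) i j(1) by (blast dest: PiE_mem)+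
      then have "i = j" using color_eq[of i "f i"] color_eq[of j "g j"] i j by simp
      then show "f i = g i" using j by simp
    qed
  qed
  then have "card rainbow = card (Pi\<^sub>E {..d} A)"
    unfolding rainbow_eq_image by (rule card_image)
  then show ?thesis by (simp add: card_PiE)
qed

text \<open>\<open>Suc d\<close> distinct colors among \<open>{..d}\<close> must exhaust them, so
  every block is hit exactly once. This identifies the support of the symbol.\<close>

lemma distinct_color_iff:
  assumes "ys \<in> lists_of V (Suc d)"
  shows "distinct (map color ys) \<longleftrightarrow> distinct ys \<and> set ys \<in> rainbow"
proof
  assume dist: "distinct (map color ys)"
  have "color ` set ys \<subseteq> {..d}" using assms color by auto
  moreover have "card (color ` set ys) = card {..d}"
    using assms distinct_card[OF dist] by simp
  ultimately have img: "color ` set ys = {..d}" by (intro card_subset_eq) auto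
  have "card (set ys \<inter> A i) = 1" if "i \<le> d" for i
  proof -
    have "i \<in> color ` set ys" using img that by simp
    then obtain v where v: "v \<in> set ys" "color v = i" by blast
    have "set ys \<inter> A i = {v}"
    proof (intro equalityI subsetI)
      fix u assume u: "u \<in> set ys \<inter> A i"
      then have "color u = color v" using color_eq[OF that] v by simp
      then have "u = v" using u v dist unfolding distinct_map by (meson IntD1 inj_onD)
      then show "u \<in> {v}" by simp
    qed (use v assms color(2)[of v] in auto)
    then show ?thesis by simp
  qed
  then show "distinct ys \<and> set ys \<in> rainbow"
    using dist assms by (auto simp: rainbow_def distinct_map)
next
  assume ys: "distinct ys \<and> set ys \<in> rainbow"
  have "inj_on color (set ys)"
  proof (rule inj_onI)
    fix u v assume uv: "u \<in> set ys" "v \<in> set ys" "color u = color v"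
    have "u \<in> V" "v \<in> V" using uv assms by auto
    then have "u \<in> set ys \<inter> A (color u)" "v \<in> set ys \<inter> A (color u)" "color u \<le> d"
      using uv color[of u] color[of v] by auto
    moreover from this have "card (set ys \<inter> A (color u)) = 1" using ys by (simp add: rainbow_def)
    ultimately show "u = v" by (metis card_1_singletonE singletonD)
  qed
  then show "distinct (map color ys)" using ys by (simp add: distinct_map)
qed

lemma card_rainbow_cell: "\<sigma> \<in> rainbow \<Longrightarrow> finite \<sigma> \<and> card \<sigma> = Suc d"
proof -
  assume \<sigma>: "\<sigma> \<in> rainbow"
  have "\<sigma> = (\<Union>i\<in>{..d}. \<sigma> \<inter> A i)" using \<sigma> part by (auto simp: rainbow_def is_partition_def)
  moreover have fin: "finite \<sigma>" using \<sigma> finV finite_subset by (auto simp: rainbow_def)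
  moreover have "card (\<Union>i\<in>{..d}. \<sigma> \<inter> A i) = (\<Sum>i\<le>d. card (\<sigma> \<inter> A i))"
    using part fin unfolding is_partition_def disjoint_family_on_def
    by (intro card_UN_disjoint) auto
  moreover have "(\<Sum>i\<le>d. card (\<sigma> \<inter> A i)) = Suc d" using \<sigma> by (simp add: rainbow_def)
  ultimately show ?thesis by metis
qed

text \<open>The squared symbol is the indicator of the orderings of transversals, of which each
  transversal has \<open>fact (Suc d)\<close>. The choice \<open>R = X\<close> serves the
  coboundary, \<open>R = UNIV\<close> the norm of the test function.\<close>

lemma sum_vandermonde_square:
  "(\<Sum>ys\<in>lists_of V (Suc d). if set ys \<in> R then (vandermonde_sign (map color ys))\<^sup>2 else 0)
    = fact (Suc d) * real (card (rainbow \<inter> R))"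
proof -
  have count: "(\<Sum>y\<in>L. if P y then 1 else 0) = real (card {y \<in> L. P y})" if "finite L"
    for L :: "'a list set" and P
    using that by (simp flip: sum.inter_filter)
  have finR: "finite rainbow" by (rule finite_subset[of _ "Pow V"]) (auto simp: rainbow_def finV)
  have "(\<Sum>ys\<in>lists_of V (Suc d). if set ys \<in> R then (vandermonde_sign (map color ys))\<^sup>2 else 0)
      = (\<Sum>ys\<in>lists_of V (Suc d). if distinct ys \<and> set ys \<in> rainbow \<inter> R then 1 else 0)"
    using distinct_color_iff
    by (intro sum.cong refl) (auto simp: power2_eq_square vandermonde_sign_square)
  also have "\<dots> = real (card {ys \<in> lists_of V (Suc d). distinct ys \<and> set ys \<in> rainbow \<inter> R})"
    by (rule count[OF finite_lists_length_eq[OF finV]])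
  also have "{ys \<in> lists_of V (Suc d). distinct ys \<and> set ys \<in> rainbow \<inter> R}
      = (\<Union>\<sigma>\<in>rainbow \<inter> R. permutations_of_set \<sigma>)"
  proof (intro equalityI subsetI)
    fix ys assume "ys \<in> (\<Union>\<sigma>\<in>rainbow \<inter> R. permutations_of_set \<sigma>)"
    then have ys: "distinct ys" "set ys \<in> rainbow" "set ys \<in> R" by (auto simp: permutations_of_set_def)
    then have "length ys = Suc d" using card_rainbow_cell distinct_card by metis
    moreover have "set ys \<subseteq> V" using ys(2) by (simp add: rainbow_def)
    ultimately show "ys \<in> {ys \<in> lists_of V (Suc d). distinct ys \<and> set ys \<in> rainbow \<inter> R}"
      using ys by simp
  qed (simp add: permutations_of_set_def)
  also have "card \<dots> = (\<Sum>\<sigma>\<in>rainbow \<inter> R. card (permutations_of_set \<sigma>))"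
  proof (rule card_UN_disjoint)
    show "\<forall>\<sigma>\<in>rainbow \<inter> R. finite (permutations_of_set \<sigma>)"
      using card_rainbow_cell by simp
  qed (use finR in \<open>auto simp: permutations_of_set_def\<close>)
  also have "\<dots> = (\<Sum>\<sigma>\<in>rainbow \<inter> R. fact (Suc d))"
    using card_rainbow_cell by (intro sum.cong refl) simp
  finally show ?thesis by (simp add: algebra_simps)
qed

section \<open>The test function, its coboundary and its norm\<close>

definition test_function :: "'a list \<Rightarrow> real" where
  "test_function xs = (\<Sum>v\<in>V. vandermonde_sign (map color (xs @ [v])))"

lemma alternating_test_function: "alternating test_function"
  unfolding alternating_def
proof (intro allI)
  fix as x y bs
  have "vandermonde_sign (map color ((as @ x # y # bs) @ [v])) = - vandermonde_sign (map color ((as @ y # x # bs) @ [v]))" for v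
    using alternatingD[OF alternating_vandermonde_sign, of "map color as" "color x" "color y" "map color bs @ [color v]"]
    by simp
  then show "test_function (as @ x # y # bs) = - test_function (as @ y # x # bs)"
    by (simp add: test_function_def sum_negf)
qed

lemma not_distinct_long:
  assumes "length cs = Suc (Suc d)" "set cs \<subseteq> {..d}"
  shows "\<not> distinct cs"
proof
  assume "distinct cs"
  then have "card (set cs) = Suc (Suc d)" using assms distinct_card by metis
  moreover have "card (set cs) \<le> card {..d}" using assms(2) by (intro card_mono) auto
  ultimately show False by simp
qed

lemma list_coboundary_vandermonde_eq_0:
  assumes "length cs = Suc (Suc d)" "set cs \<subseteq> {..d}"
  shows "list_coboundary vandermonde_sign cs = 0"
  by (rule alternating_not_distinct[OF alternating_list_coboundary[OF alternating_vandermonde_sign]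
    not_distinct_long[OF assms]])

text \<open>For each \<open>v\<close> the coboundary of the symbol vanishes at the colors of
  \<open>ys @ [v]\<close>. Its last term deletes \<open>v\<close> and leaves the symbol of
  \<open>ys\<close> with sign \<open>(-1) ^ Suc d\<close>, which determines the sum of the others;
  adding up over \<open>v\<close> produces the factor \<open>card V\<close>.\<close>

lemma list_coboundary_test_function:
  assumes ys: "ys \<in> lists_of V (Suc d)"
  shows "list_coboundary test_function ys = (- 1) ^ d * real (card V) * vandermonde_sign (map color ys)"
proof -
  have len: "length ys = Suc d" using ys by simp
  have "(\<Sum>i<Suc d. (- 1) ^ i * vandermonde_sign (map color ((take i ys @ drop (Suc i) ys) @ [v])))
     = (- 1) ^ d * vandermonde_sign (map color ys)" if v: "v \<in> V" for v
  proof -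
    let ?cs = "map color (ys @ [v])"
    have "set ?cs \<subseteq> {..d}" using ys v color by auto
    then have "0 = list_coboundary vandermonde_sign ?cs"
      using len by (intro list_coboundary_vandermonde_eq_0[symmetric]) auto
    also have "\<dots> = (\<Sum>i<Suc d. (- 1) ^ i * vandermonde_sign (take i ?cs @ drop (Suc i) ?cs))
       + (- 1) ^ Suc d * vandermonde_sign (map color ys)"
      using len by (simp add: list_coboundary_def)
    also have "(\<Sum>i<Suc d. (- 1) ^ i * vandermonde_sign (take i ?cs @ drop (Suc i) ?cs))
      = (\<Sum>i<Suc d. (- 1) ^ i * vandermonde_sign (map color ((take i ys @ drop (Suc i) ys) @ [v])))"
      using len by (intro sum.cong refl) (simp add: take_map drop_map)
    finally show ?thesis by (simp del: sum.lessThan_Suc)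
  qed
  then have "(\<Sum>v\<in>V. \<Sum>i<Suc d. (- 1) ^ i * vandermonde_sign (map color ((take i ys @ drop (Suc i) ys) @ [v])))
     = (- 1) ^ d * real (card V) * vandermonde_sign (map color ys)" by (simp del: sum.lessThan_Suc)
  then show ?thesis
    unfolding list_coboundary_def test_function_def sum_distrib_left len
    by (subst sum.swap)
qed

text \<open>For different colors of \<open>u\<close> and \<open>v\<close>, both factors being
  nonzero would require \<open>d + 2\<close> distinct colors. For equal colors the product is a
  square, which depends only on distinctness and so not on the place of \<open>u\<close>.\<close>

lemma vandermonde_product:
  assumes "xs \<in> lists_of V d" "u \<in> V" "v \<in> V"
  shows "vandermonde_sign (map color (xs @ [u])) * vandermonde_sign (map color (xs @ [v]))
    = (if color u = color v then (vandermonde_sign (map color (u # xs)))\<^sup>2 else 0)"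
proof (cases "color u = color v")
  case True
  then have "map color (xs @ [v]) = map color (xs @ [u])" by simp
  then show ?thesis
    using True unfolding power2_eq_square vandermonde_sign_square
    by (simp only: vandermonde_sign_square) auto
next
  case False
  have "\<not> distinct (map color (u # v # xs))"
    by (rule not_distinct_long) (use assms color in auto)
  then have "\<not> distinct (map color (xs @ [u])) \<or> \<not> distinct (map color (xs @ [v]))"
    using False by auto
  then show ?thesis
    using False alternating_not_distinct[OF alternating_vandermonde_sign] by (auto simp del: map_append)
qed

text \<open>Expanding the square leaves pairs of vertices in one block, that is, a sum over lists of
  length \<open>Suc d\<close> of the squared symbol weighted by the block size of the head.
  Averaging the weight over all positions replaces it by \<open>card V / Suc d\<close>.\<close>

lemma test_function_norm:
  "(\<Sum>xs\<in>lists_of V d. (test_function xs)\<^sup>2) = fact d * real (card V) * (\<Prod>i\<le>d. real (card (A i)))"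
proof -
  define w where "w ys = (vandermonde_sign (map color ys))\<^sup>2" for ys
  define b where "b v = real (card (A (color v)))" for v
  have "(\<Sum>xs\<in>lists_of V d. (test_function xs)\<^sup>2) = (\<Sum>xs\<in>lists_of V d. \<Sum>u\<in>V. b u * w (u # xs))"
  proof (rule sum.cong[OF refl])
    fix xs assume xs: "xs \<in> lists_of V d"
    have "(test_function xs)\<^sup>2 = (\<Sum>u\<in>V. \<Sum>v\<in>V. if color u = color v then w (u # xs) else 0)"
      unfolding test_function_def power2_eq_square[of "sum _ _"] sum_product w_def
      by (intro sum.cong refl vandermonde_product[OF xs])
    also have "\<dots> = (\<Sum>u\<in>V. b u * w (u # xs))"
    proof (rule sum.cong[OF refl])
      fix u assume u: "u \<in> V"
      have "(\<Sum>v\<in>V. if color u = color v then w (u # xs) else 0) = (\<Sum>v | v \<in> V \<and> color v = color u. w (u # xs))"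
        using sum.inter_filter[OF finV, of "\<lambda>_. w (u # xs)" "\<lambda>v. color v = color u"]
        by (simp only: eq_commute[of "color u"])
      then show "(\<Sum>v\<in>V. if color u = color v then w (u # xs) else 0) = b u * w (u # xs)"
        using color_class[OF color(1)[OF u]] by (simp add: b_def)
    qed
    finally show "(test_function xs)\<^sup>2 = (\<Sum>u\<in>V. b u * w (u # xs))" .
  qed
  also have "\<dots> = (\<Sum>ys\<in>lists_of V (Suc d). b (hd ys) * w ys)"
    by (simp add: sum_lists_of_Suc)
  finally have norm: "(\<Sum>xs\<in>lists_of V d. (test_function xs)\<^sup>2) = (\<Sum>ys\<in>lists_of V (Suc d). b (hd ys) * w ys)" .
  \<comment> \<open>Moving an entry to the front changes the symbol only by a sign, so its square
    lets any position take the role of the head.\<close>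
  have hd_eq: "(\<Sum>ys\<in>lists_of V (Suc d). b (hd ys) * w ys) = (\<Sum>ys\<in>lists_of V (Suc d). b (ys ! i) * w ys)"
    if i: "i < Suc d" for i
  proof -
    have "(\<Sum>ys\<in>lists_of V (Suc d). b (hd ys) * w ys)
       = (\<Sum>ys\<in>lists_of V (Suc d). b (hd (ys ! i # take i ys @ drop (Suc i) ys)) * w (ys ! i # take i ys @ drop (Suc i) ys))"
      using i by (intro sum_lists_of_move_front[symmetric]) auto
    also have "\<dots> = (\<Sum>ys\<in>lists_of V (Suc d). b (ys ! i) * w ys)"
    proof (rule sum.cong[OF refl])
      fix ys assume "ys \<in> lists_of V (Suc d)"
      then have "i < length (map color ys)" using i by simp
      from alternating_move_front[OF alternating_vandermonde_sign this]
      have "vandermonde_sign (map color (ys ! i # take i ys @ drop (Suc i) ys)) = (- 1) ^ i * vandermonde_sign (map color ys)"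
        using \<open>i < length (map color ys)\<close> by (simp add: take_map drop_map del: vandermonde_sign.simps)
      then show "b (hd (ys ! i # take i ys @ drop (Suc i) ys)) * w (ys ! i # take i ys @ drop (Suc i) ys) = b (ys ! i) * w ys"
        unfolding w_def by (simp add: power_mult_distrib minus_one_power_iff del: vandermonde_sign.simps)
    qed
    finally show ?thesis .
  qed
  have "(\<Sum>i<Suc d. \<Sum>ys\<in>lists_of V (Suc d). b (hd ys) * w ys)
     = (\<Sum>i<Suc d. \<Sum>ys\<in>lists_of V (Suc d). b (ys ! i) * w ys)"
    by (rule sum.cong[OF refl], rule hd_eq) simp
  then have "real (Suc d) * (\<Sum>ys\<in>lists_of V (Suc d). b (hd ys) * w ys)
     = (\<Sum>i<Suc d. \<Sum>ys\<in>lists_of V (Suc d). b (ys ! i) * w ys)"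
    by (simp only: sum_constant card_lessThan)
  also have "\<dots> = (\<Sum>ys\<in>lists_of V (Suc d). (\<Sum>i<Suc d. b (ys ! i)) * w ys)"
    by (subst sum.swap) (simp add: sum_distrib_right del: sum.lessThan_Suc)
  also have "\<dots> = (\<Sum>ys\<in>lists_of V (Suc d). real (card V) * w ys)"
  proof (rule sum.cong[OF refl])
    fix ys assume ys: "ys \<in> lists_of V (Suc d)"
    show "(\<Sum>i<Suc d. b (ys ! i)) * w ys = real (card V) * w ys"
    proof (cases "distinct (map color ys)")
      case True
      have "color ` set ys \<subseteq> {..d}" using ys color by auto
      moreover have "card (color ` set ys) = card {..d}"
        using ys distinct_card[OF True] by simp
      \<comment> \<open>Each block occurs exactly once among the entries, so their block sizes add
        up to \<open>card V\<close>.\<close>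
      ultimately have img: "set (map color ys) = {..d}" by simp (intro card_subset_eq, auto)
      have "(\<Sum>i<Suc d. b (ys ! i)) = (\<Sum>i<length (map color ys). real (card (A (map color ys ! i))))"
        using ys by (intro sum.cong) (auto simp: b_def)
      also have "\<dots> = (\<Sum>c\<in>set (map color ys). real (card (A c)))"
        by (rule sum.reindex_bij_betw[OF bij_betw_nth[OF True refl refl]])
      also have "\<dots> = real (card V)" unfolding img by (simp flip: sum_card_classes)
      finally show ?thesis by simp
    next
      case False
      then show ?thesis by (simp add: w_def alternating_not_distinct[OF alternating_vandermonde_sign])
    qed
  qed
  also have "\<dots> = real (card V) * (\<Sum>ys\<in>lists_of V (Suc d). w ys)" by (simp add: sum_distrib_left)
  also have "(\<Sum>ys\<in>lists_of V (Suc d). w ys) = fact (Suc d) * (\<Prod>i\<le>d. real (card (A i)))"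
    using sum_vandermonde_square[of UNIV] by (simp add: w_def card_rainbow)
  finally have "real (Suc d) * (\<Sum>xs\<in>lists_of V d. (test_function xs)\<^sup>2)
     = real (Suc d) * (fact d * real (card V) * (\<Prod>i\<le>d. real (card (A i))))"
    unfolding norm by simp
  then show ?thesis by simp
qed

end

section \<open>The Rayleigh quotient of the test form\<close>

lemma (in finite_complex) spectral_gap_le:
  assumes dim: "complex_dim X = int d" "d \<ge> 1" and skel: "complete_skeleton V X"
    and part: "is_partition V d A"
  shows "spectral_gap X \<le> real (card V) * real (card (transversal_cells X d A)) / (\<Prod>i\<le>d. real (card (A i)))"
proof -
  interpret coloring V d A using finite_V part by unfold_locales
  interpret symmetric_operator "lists_of V d" orient "cycles X (complex_dim X - 1)" "upper_laplacian X"
    by (rule symmetric_operator_upper_laplacian[OF dim])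
  define f where "f \<sigma> = (if \<sigma> \<in> oriented_cells X (int d - 1) then test_function (SOME ys. ys \<in> \<sigma>) else 0)" for \<sigma>
  have f0: "f \<sigma> = 0" if "\<sigma> \<notin> oriented_cells X (int d - 1)" for \<sigma>
    using that by (simp add: f_def)
  have f_orient: "f (orient xs) = (if orient xs \<in> oriented_cells X (int d - 1) then test_function xs else 0)" for xs
    by (simp add: f_def alternating_orient_SOME[OF alternating_test_function])
  \<comment> \<open>The complete skeleton enters here: every repetition-free list of
    \<open>d\<close> vertices orders a cell, and on other lists \<open>test_function\<close> is
    \<open>0\<close>, so cutting it down to cells loses nothing.\<close>
  have f_lists: "f (orient xs) = test_function xs" if xs: "xs \<in> lists_of V d" for xs
  proof (cases "distinct xs")
    case True
    then have "card (set xs) = d" using xs distinct_card by blast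
    then have "set xs \<in> cells X (int d - 1)"
      using skel xs dim by (simp add: complete_skeleton_def cells_def cell_dim_def)
    then show ?thesis using True by (simp add: f_orient orient_in_oriented_cells)
  next
    case False
    then show ?thesis
      by (simp add: f_orient alternating_not_distinct[OF alternating_test_function])
  qed
  have "alternating (\<lambda>xs. f (orient xs))"
    unfolding alternating_def
  proof (intro allI)
    fix as bs :: "'a list" and x y
    have "orient (as @ x # y # bs) \<in> oriented_cells X (int d - 1) \<longleftrightarrow>
        orient (as @ y # x # bs) \<in> oriented_cells X (int d - 1)"
      by (auto simp: orient_in_oriented_cells insert_commute)
    then show "f (orient (as @ x # y # bs)) = - f (orient (as @ y # x # bs))"
      unfolding f_orient using alternatingD[OF alternating_test_function, of as x y bs] by simp
  qed
  then have forms: "f \<in> forms X (int d - 1)" using f0 dim by (subst forms_iff) auto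
  have "boundary X (int d - 1) f \<sigma> = 0" for \<sigma>
  proof (cases "\<sigma> \<in> oriented_cells X (int d - 1 - 1)")
    case True
    then obtain xs where xs: "\<sigma> = orient xs" "set xs \<in> cells X (int d - 1 - 1)" "int (length xs) = int d - 1 - 1 + 1"
      by (rule oriented_cellsE)
    have "v # xs \<in> lists_of V d" if "v \<in> V" for v
      using xs that cell_subset[of "set xs"] by (simp add: cells_def)
    then have "(\<Sum>v\<in>V. f (orient (v # xs))) = (\<Sum>v\<in>V. test_function (v # xs))"
      by (intro sum.cong refl f_lists)
    also have "\<dots> = (\<Sum>v\<in>V. \<Sum>u\<in>V. vandermonde_sign (map color (v # xs @ [u])))"
      by (simp add: test_function_def)
    also have "\<dots> = 0"
    \<comment> \<open>The added vertex \<open>v\<close> at the front and the summation vertex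
      \<open>u\<close> at the end are exchanged across \<open>xs\<close>, which negates the
      symbol.\<close>
    proof (rule antisymmetric_sum_eq_0)
      show "vandermonde_sign (map color (v # xs @ [u])) = - vandermonde_sign (map color (u # xs @ [v]))" for u v
        using alternating_exchange[OF alternating_vandermonde_sign, of "[]" "color v" "map color xs" "color u" "[]"]
        by (simp del: vandermonde_sign.simps)
    qed
    finally have "(\<Sum>v\<in>V. f (orient (v # xs))) = 0" .
    moreover have "boundary X (int d - 1) f (orient xs) = (\<Sum>v\<in>V. f (orient (v # xs)))"
      by (rule boundary_orient) (rule f0)
    ultimately show ?thesis by (simp add: xs(1))
  qed (simp add: boundary_def)
  then have cycle: "f \<in> cycles X (complex_dim X - 1)"
    using forms dim by (auto simp: cycles_def)
  define P where "P = (\<Prod>i\<le>d. real (card (A i)))"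
  have P: "P > 0" unfolding P_def using card_class_pos by (intro prod_pos) auto
  have "card V > 0"
    using card_class_pos[of 0] card_mono[OF finV A_subset[of 0]] by simp
  have norm: "ip f f = fact d * real (card V) * P"
  proof -
    have "ip f f = (\<Sum>xs\<in>lists_of V d. (test_function xs)\<^sup>2)"
      unfolding ip_def power2_eq_square by (intro sum.cong refl) (simp only: f_lists)
    then show ?thesis by (simp add: test_function_norm P_def)
  qed
  then have "f \<noteq> (\<lambda>_. 0)" using P \<open>card V > 0\<close> by (auto simp: ip_def)
  have coboundary_f: "(coboundary X (int d) f (orient ys))\<^sup>2 = (real (card V))\<^sup>2 *
      (if set ys \<in> X then (vandermonde_sign (map color ys))\<^sup>2 else 0)" if ys: "ys \<in> lists_of V (Suc d)" for ys
  proof (cases "distinct ys")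
    case True
    have "take i ys @ drop (Suc i) ys \<in> lists_of V d" if "i < Suc d" for i
      using that ys by (auto dest!: in_set_takeD in_set_dropD)
    then have "list_coboundary (\<lambda>xs. f (orient xs)) ys = list_coboundary test_function ys"
      unfolding list_coboundary_def using ys by (intro sum.cong refl) (simp only: f_lists mem_Collect_eq lessThan_iff)
    moreover have "orient ys \<in> oriented_cells X (int d) \<longleftrightarrow> set ys \<in> X"
      using True ys by (simp add: orient_in_oriented_cells cells_def cell_dim_def distinct_card)
    ultimately show ?thesis
      using coboundary_orient[OF forms, of ys] dim list_coboundary_test_function[OF ys]
      by (simp add: power_mult_distrib minus_one_power_iff)
  next
    case False
    then show ?thesis
      using coboundary_orient[OF forms, of ys] dim
        alternating_not_distinct[OF alternating_vandermonde_sign, of "map color ys"]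
      by (simp add: orient_in_oriented_cells distinct_map)
  qed
  have "transversal_cells X d A = rainbow \<inter> X"
  proof (intro equalityI subsetI)
    fix \<sigma> assume "\<sigma> \<in> transversal_cells X d A"
    then show "\<sigma> \<in> rainbow \<inter> X"
      using cell_subset[of \<sigma>] by (simp add: transversal_cells_def rainbow_def cells_def)
  next
    fix \<sigma> assume "\<sigma> \<in> rainbow \<inter> X"
    then show "\<sigma> \<in> transversal_cells X d A"
      using card_rainbow_cell[of \<sigma>]
      by (simp add: transversal_cells_def rainbow_def cells_def cell_dim_def)
  qed
  moreover have "(\<Sum>ys\<in>lists_of V (Suc d). (coboundary X (int d) f (orient ys))\<^sup>2)
     = (\<Sum>ys\<in>lists_of V (Suc d). (real (card V))\<^sup>2 *
         (if set ys \<in> X then (vandermonde_sign (map color ys))\<^sup>2 else 0))"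
    by (rule sum.cong[OF refl coboundary_f])
  ultimately have "(\<Sum>ys\<in>lists_of V (Suc d). (coboundary X (int d) f (orient ys))\<^sup>2)
     = (real (card V))\<^sup>2 * (fact (Suc d) * real (card (transversal_cells X d A)))"
    by (simp only: sum_distrib_left[symmetric] sum_vandermonde_square)
  moreover have "real (Suc d) * ip (upper_laplacian X f) f = (\<Sum>ys\<in>lists_of V (Suc d). (coboundary X (int d) f (orient ys))\<^sup>2)"
    using sum_boundary_coboundary[OF forms forms dim(2)]
    by (simp only: ip_def upper_laplacian_def dim(1) power2_eq_square)
  \<comment> \<open>Cancelling \<open>Suc d\<close> turns \<open>fact (Suc d)\<close> into
    \<open>fact d\<close>, the factor that also occurs in the norm; together with one factor
    \<open>card V\<close> it drops out of the quotient.\<close>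
  ultimately have "ip (upper_laplacian X f) f = (real (card V))\<^sup>2 * (fact d * real (card (transversal_cells X d A)))"
    by simp
  then have "spectral_gap X * (fact d * real (card V) * P) \<le> (real (card V))\<^sup>2 * (fact d * real (card (transversal_cells X d A)))"
    using Min_spectrum_le[OF cycle \<open>f \<noteq> (\<lambda>_. 0)\<close>] norm by (simp add: spectral_gap_def)
  then have "(fact d * real (card V)) * (spectral_gap X * P) \<le> (fact d * real (card V)) * (real (card V) * real (card (transversal_cells X d A)))"
    by (simp add: power2_eq_square mult_ac)
  then have "spectral_gap X * P \<le> real (card V) * real (card (transversal_cells X d A))"
    by (rule mult_left_le_imp_le) (use \<open>card V > 0\<close> in simp)
  then show ?thesis using P unfolding P_def[symmetric] by (simp add: pos_le_divide_eq)
qed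

section \<open>Existence of partitions and passage to the minimum\<close>

lemma ex_partition:
  assumes "finite V" "\<sigma> \<subseteq> V" "card \<sigma> = Suc d"
  shows "\<exists>A. is_partition V d A"
proof -
  have "finite \<sigma>" using assms finite_subset by blast
  then obtain h where h: "bij_betw h {0..<Suc d} \<sigma>"
    using ex_bij_betw_nat_finite assms(3) by metis
  \<comment> \<open>The first \<open>d\<close> vertices of the cell become singleton blocks and the
    last block takes the rest of \<open>V\<close>, which still contains \<open>h d\<close>.\<close>
  define A where "A i = (if i = d then V - h ` {..<d} else {h i})" for i
  have inj: "h i = h j \<longleftrightarrow> i = j" if "i \<le> d" "j \<le> d" for i j
    using h that by (auto simp: bij_betw_def inj_on_def)
  have hV: "h i \<in> V" if "i \<le> d" for i
    using bij_betwE[OF h] assms(2) that by auto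
  have "h d \<in> A d" using inj hV by (auto simp: A_def)
  then have "\<forall>i\<le>d. A i \<noteq> {}" by (auto simp: A_def)
  moreover have "disjoint_family_on A {..d}"
    unfolding disjoint_family_on_def using inj by (auto simp: A_def)
  moreover have "(\<Union>i\<le>d. A i) = V"
  proof (intro equalityI subsetI)
    fix v assume v: "v \<in> V"
    show "v \<in> (\<Union>i\<le>d. A i)"
    proof (cases "v \<in> h ` {..<d}")
      case True
      then obtain i where "i < d" "v \<in> A i" by (auto simp: A_def)
      then show ?thesis by (intro UN_I[of i]) auto
    next
      case False
      then show ?thesis using v by (intro UN_I[of d]) (auto simp: A_def)
    qed
  qed (use hV in \<open>auto simp: A_def split: if_splits\<close>)
  ultimately show ?thesis by (auto simp: is_partition_def)
qed

theorem theorem1p2: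
  fixes V :: "'a set" and X :: "'a set set"
  assumes "finite V"
    and "abstract_simplicial_complex V X"
    and "complex_dim X \<ge> 1"
    and "complete_skeleton V X"
  shows "spectral_gap X \<le> cheeger_constant V X"
proof -
  interpret finite_complex V X using assms(1,2) by unfold_locales
  define d where "d = nat (complex_dim X)"
  have d: "complex_dim X = int d" "d \<ge> 1" using assms(3) by (auto simp: d_def)
  define ratio where "ratio A = real (card V) * real (card (transversal_cells X d A)) / (\<Prod>i\<le>d. real (card (A i)))" for A
  have "finite X" using cell_subset finite_V by (metis PowI finite_Pow_iff finite_subset subsetI)
  moreover have "X \<noteq> {}" using assms(2) by (auto simp: abstract_simplicial_complex_def)
  \<comment> \<open>The dimension is attained by a cell with \<open>Suc d\<close> vertices, so a
    partition exists and the Cheeger minimum is over a nonempty set.\<close>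
  ultimately have "complex_dim X \<in> cell_dim ` X"
    unfolding complex_dim_def by (intro Max_in) auto
  then obtain \<sigma> where "\<sigma> \<in> X" "card \<sigma> = Suc d" using d by (auto simp: cell_dim_def)
  then have "{ratio A | A. is_partition V d A} \<noteq> {}"
    using ex_partition[OF finite_V cell_subset] by blast
  \<comment> \<open>The families \<open>A\<close> are unconstrained beyond \<open>d\<close>, so
    there may be infinitely many; the quotient depends only on the restriction to
    \<open>{..d}\<close>, which leaves finitely many values.\<close>
  moreover have "finite {ratio A | A. is_partition V d A}"
  proof (rule finite_subset)
    show "{ratio A | A. is_partition V d A} \<subseteq> ratio ` (Pi\<^sub>E {..d} (\<lambda>_. Pow V))"
    proof clarify
      fix A assume A: "is_partition V d A"
      have "ratio A = ratio (restrict A {..d})"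
        by (simp add: ratio_def transversal_cells_def)
      moreover have "restrict A {..d} \<in> Pi\<^sub>E {..d} (\<lambda>_. Pow V)"
        using A by (auto simp: is_partition_def)
      ultimately show "ratio A \<in> ratio ` (Pi\<^sub>E {..d} (\<lambda>_. Pow V))" by blast
    qed
    show "finite (ratio ` (Pi\<^sub>E {..d} (\<lambda>_. Pow V)))"
      using finite_V by (intro finite_imageI finite_PiE) auto
  qed
  ultimately have "Min {ratio A | A. is_partition V d A} \<in> {ratio A | A. is_partition V d A}"
    by (intro Min_in)
  moreover have "cheeger_constant V X = Min {ratio A | A. is_partition V d A}"
    by (simp add: cheeger_constant_def ratio_def d_def Let_def)
  moreover have "spectral_gap X \<le> ratio A" if "is_partition V d A" for A
    unfolding ratio_def by (rule spectral_gap_le[OF d assms(4) that])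
  ultimately show ?thesis by auto
qed

end
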